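(* Fix $n\in\mathbb N$ and let $\pi_0<_{lex}\pi_1<_{lex}\dots<_{lex}\pi_k$ be the list of all fixed points of PSSPM($n$), ordered lexicographically. Then $\pi_0\triangleleft\pi_1\triangleleft\dots\triangleleft\pi_{k-1}\triangleleft\pi_k$. Moreover, for every fixed point $\pi$ of SSPM($n$) with $\pi_0\le_{lex}\pi\le_{lex}\pi_k$, there exists an index $i$, $0\le i\le k$, with $\pi_i=\pi$.
   Context: A configuration is a sequence $(c_i)_{i\in\mathbb Z}$ of nonnegative integers with only finitely many positive values; $(\underline{n})$ denotes the configuration with $c_0=n$ and $c_i=0$ otherwise. Rule $\mathcal L$ at column $i$ is applicable if $c_{i-1}+2\le c_i$ and moves one grain from column $i$ to column $i-1$; rule $\mathcal R$ at column $i$ is applicable if $c_i\ge c_{i+1}+2$ and moves one grain from column $i$ to column $i+1$. An SSPM transition applies exactly one applicable rule at one column. A PSSPM transition applies rules simultaneously on every column where some rule is applicable, at most one rule per column (choosing one when both apply). SSPM($n$) (resp. PSSPM($n$)) is the set of configurations reachable from $(\underline{n})$ by finitely many SSPM (resp. PSSPM) transitions; a fixed point of SSPM($n$) (resp. PSSPM($n$)) is an element of that set on which no rule is applicable. Lexicographic order: $a<_{lex} b$ iff $a\ne b$ and $a_i<b_i$ at the smallest index $i$ with $a_i\ne b_i$. For configurations $a,b$, $a\triangleleft b$ means: there exist indices $i<j$ with $a_i-b_i=-1$, $a_j-b_j=1$, and $a_m=b_m$ for all $m\notin\{i,j\}$. *)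

theory Defs
  imports Main
begin

type_synonym config = "int \<Rightarrow> nat"

definition is_config :: "config \<Rightarrow> bool" where
  "is_config c \<longleftrightarrow> finite {i. c i > 0}"

definition single :: "nat \<Rightarrow> config" where
  "single n = (\<lambda>i. if i = 0 then n else 0)"

definition L_app :: "config \<Rightarrow> int \<Rightarrow> bool" where
  "L_app c i \<longleftrightarrow> c (i - 1) + 2 \<le> c i"

definition R_app :: "config \<Rightarrow> int \<Rightarrow> bool" where
  "R_app c i \<longleftrightarrow> c i \<ge> c (i + 1) + 2"

definition apply_rules :: "config \<Rightarrow> int set \<Rightarrow> int set \<Rightarrow> config" where
  "apply_rules c A B = (\<lambda>i. c i - (if i \<in> A then 1 else 0) - (if i \<in> B then 1 else 0)
        + (if i + 1 \<in> A then 1 else 0) + (if i - 1 \<in> B then 1 else 0))"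

definition sspm_step :: "config \<Rightarrow> config \<Rightarrow> bool" where
  "sspm_step c d \<longleftrightarrow> (\<exists>i. (L_app c i \<and> d = apply_rules c {i} {}) \<or>
                             (R_app c i \<and> d = apply_rules c {} {i}))"

definition pspm_step :: "config \<Rightarrow> config \<Rightarrow> bool" where
  "pspm_step c d \<longleftrightarrow> (\<exists>A B. A \<inter> B = {} \<and> A \<union> B = {i. L_app c i \<or> R_app c i}
      \<and> (\<forall>i\<in>A. L_app c i) \<and> (\<forall>i\<in>B. R_app c i) \<and> A \<union> B \<noteq> {}
      \<and> d = apply_rules c A B)"

definition SSPM :: "nat \<Rightarrow> config set" where
  "SSPM n = {c. sspm_step\<^sup>*\<^sup>* (single n) c}"

definition PSSPM :: "nat \<Rightarrow> config set" where
  "PSSPM n = {c. pspm_step\<^sup>*\<^sup>* (single n) c}"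

definition is_fixed :: "config \<Rightarrow> bool" where
  "is_fixed c \<longleftrightarrow> (\<forall>i. \<not> L_app c i \<and> \<not> R_app c i)"

definition SSPM_fixed :: "nat \<Rightarrow> config set" where
  "SSPM_fixed n = {c \<in> SSPM n. is_fixed c}"

definition PSSPM_fixed :: "nat \<Rightarrow> config set" where
  "PSSPM_fixed n = {c \<in> PSSPM n. is_fixed c}"

definition lex_less :: "config \<Rightarrow> config \<Rightarrow> bool" where
  "lex_less a b \<longleftrightarrow> a \<noteq> b \<and> (\<exists>i. a i < b i \<and> (\<forall>m<i. a m = b m))"

definition lex_le :: "config \<Rightarrow> config \<Rightarrow> bool" where
  "lex_le a b \<longleftrightarrow> a = b \<or> lex_less a b"

definition tri :: "config \<Rightarrow> config \<Rightarrow> bool" where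
  "tri a b \<longleftrightarrow> (\<exists>i j. i < j \<and> int (a i) - int (b i) = -1 \<and> int (a j) - int (b j) = 1
      \<and> (\<forall>m. m \<noteq> i \<and> m \<noteq> j \<longrightarrow> a m = b m))"

end

theory Submission
  imports Defs
begin

text \<open>
  Let \<open>F\<^sub>c m\<close> be the number of grains of \<open>c\<close> strictly to the left of column \<open>m\<close>. Rule L at \<open>m\<close> raises
  \<open>F\<^sub>c m\<close> by one when its second difference is at least 2, rule R at \<open>m - 1\<close> lowers it by one when
  the second difference is at most -2, so the parallel dynamics is monotone in \<open>F\<close> and commutes with
  adding a constant. Hence \<open>F\<^sub>x \<le> F\<^sub>y \<le> F\<^sub>x + 1\<close> can be maintained by suitable choices at the peaks, and
  the two successors of a configuration with a choice lead to fixed points related in this way.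
  Consequently the fixed points of PSSPM(n) are connected under this relation.

  Every fixed point has the form \<open>max 0 (min l r)\<close>, where \<open>l\<close> is a staircase of slope 1 with at most
  one plateau and \<open>r\<close> is a mirrored one. Staircases are totally ordered pointwise, so passing to a
  lexicographically larger fixed point with the same number of grains raises \<open>l\<close> and lowers \<open>r\<close>, and
  all columns that gain lie to the left of all columns that lose. Two related distinct fixed points
  therefore differ by a single grain, and no fixed point lies strictly between them, unless that
  fixed point is a perfect pyramid. The exception never arises, because grain counts at the centre
  column propagate it backwards to a configuration in which a choice is impossible.
\<close>

section \<open>Cumulative grain counts\<close>

text \<open>Only nonempty columns are summed, which keeps the index set finite; a sum over the
  infinite set of all \<open>k < m\<close> would default to 0.\<close>

definition cum :: "config \<Rightarrow> int \<Rightarrow> int" where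
  "cum c m = (\<Sum>k | k < m \<and> 0 < c k. int (c k))"

definition grains :: "config \<Rightarrow> int" where
  "grains c = (\<Sum>k | 0 < c k. int (c k))"

definition mirror :: "config \<Rightarrow> config" where
  "mirror c = (\<lambda>i. c (- i))"

lemma mirror_apply [simp]: "mirror c i = c (- i)"
  by (simp add: mirror_def)

lemma mirror_mirror [simp]: "mirror (mirror c) = c"
  by (simp add: mirror_def)

lemma uminus_mem: "(i::int) \<in> uminus ` S \<longleftrightarrow> - i \<in> S"
  by (auto simp: image_iff intro: bexI[of _ "- i"])

lemma is_config_mirror [simp]: "is_config (mirror c) \<longleftrightarrow> is_config c"
proof -
  have "{i. 0 < mirror c i} = uminus ` {i. 0 < c i}"
    by (auto simp: uminus_mem)
  moreover have "inj_on uminus {i. 0 < c i}" by simp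
  ultimately show ?thesis unfolding is_config_def by (simp add: finite_image_iff del: mirror_apply)
qed

lemma cum_Suc: 
  assumes "is_config c" shows "cum c (m + 1) = cum c m + int (c m)"
proof -
  have fin: "finite {k. k < m \<and> 0 < c k}"
    using assms unfolding is_config_def by (rule rev_finite_subset) auto
  show ?thesis
  proof (cases "c m = 0")
    case True
    then have "{k. k < m + 1 \<and> 0 < c k} = {k. k < m \<and> 0 < c k}"
      by (auto simp: order_le_less)
    with True show ?thesis by (simp add: cum_def)
  next
    case False
    then have "{k. k < m + 1 \<and> 0 < c k} = insert m {k. k < m \<and> 0 < c k}" by auto
    with fin show ?thesis by (simp add: cum_def)
  qed
qed

lemma cum_low: 
  assumes "is_config c" shows "\<exists>m0. \<forall>m\<le>m0. cum c m = 0 \<and> c m = 0"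
proof -
  have "finite {i. 0 < c i}" using assms by (simp add: is_config_def)
  then obtain b where b: "\<And>i. 0 < c i \<Longrightarrow> b \<le> i"
    by (metis (mono_tags, lifting) mem_Collect_eq bdd_below_finite bdd_below_def)
  have "cum c m = 0 \<and> c m = 0" if "m \<le> b - 1" for m
  proof -
    have "{k. k < m \<and> 0 < c k} = {}" using b that by force
    moreover have "c m = 0" using b[of m] that by force
    ultimately show ?thesis by (simp only: cum_def) simp
  qed
  then show ?thesis by blast
qed

text \<open>Discrete comparison from the far left, where \<open>cum\<close> vanishes:
  \<open>g\<close> starts no lower and its increments dominate the columns.\<close>

lemma cum_le:
  assumes c: "is_config c" and d: "\<And>k. k < m \<Longrightarrow> int (c k) \<le> g (k + 1) - g k" and g: "\<And>k. 0 \<le> g k"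
  shows "cum c m \<le> g m"
proof -
  obtain m0 where m0: "\<And>m. m \<le> m0 \<Longrightarrow> cum c m = 0" using cum_low[OF c] by blast
  have "cum c k \<le> g k" if "min m0 m \<le> k" "k \<le> m" for k
    using that
  proof (induction k rule: int_ge_induct)
    case base then show ?case using m0 g by simp
  next
    case (step k) then show ?case using cum_Suc[OF c, of k] d[of k] by simp
  qed
  then show ?thesis by simp
qed

lemma cum_ge:
  assumes c: "is_config c" and d: "\<And>k. k < m \<Longrightarrow> g (k + 1) - g k \<le> int (c k)" and g: "\<And>k. k \<le> b \<Longrightarrow> g k = 0"
  shows "g m \<le> cum c m"
proof -
  obtain m0 where m0: "\<And>m. m \<le> m0 \<Longrightarrow> cum c m = 0" using cum_low[OF c] by blast
  have "g k \<le> cum c k" if "min b (min m0 m) \<le> k" "k \<le> m" for k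
    using that
  proof (induction k rule: int_ge_induct)
    case base then show ?case using m0 g by simp
  next
    case (step k) then show ?case using cum_Suc[OF c, of k] d[of k] by simp
  qed
  then show ?thesis by simp
qed

lemma cum_nonneg: "0 \<le> cum c m"
  by (simp add: cum_def sum_nonneg)

lemma cum_mono:
  assumes c: "is_config c" and d: "is_config d" and le: "\<And>k. k < m \<Longrightarrow> c k \<le> d k"
  shows "cum c m \<le> cum d m"
  by (rule cum_le[OF c]) (use le cum_Suc[OF d] cum_nonneg in \<open>auto\<close>)

lemma cum_eqI:
  assumes c: "is_config c" and d: "\<And>k. g (k + 1) - g k = int (c k)" and g: "\<And>k. k \<le> b \<Longrightarrow> g k = 0"
  shows "cum c m = g m"
proof (rule antisym)
  show "g m \<le> cum c m" by (rule cum_ge[OF c _ g]) (use d in auto)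
  have mono: "g k \<le> g l" if "k \<le> l" for k l
    using that
  proof (induction l rule: int_ge_induct)
    case (step l) then show ?case using d[of l] by simp
  qed simp
  have "0 \<le> g k" for k using mono[of "min b k" k] g[of "min b k"] by simp
  then show "cum c m \<le> g m" by (intro cum_le[OF c]) (use d in auto)
qed

text \<open>Mirroring turns \<open>k \<ge> m\<close> into \<open>- k < 1 - m\<close>, so the second
  term counts the grains from column \<open>m\<close> on. Bounds on left counts are carried to the
  right side this way.\<close>

lemma cum_mirror:
  assumes "is_config c" shows "cum c m + cum (mirror c) (1 - m) = grains c"
proof -
  have fin: "finite {k. 0 < c k}" using assms by (simp add: is_config_def)
  have "cum (mirror c) (1 - m) = (\<Sum>k | m \<le> k \<and> 0 < c k. int (c k))"
    unfolding cum_def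
    by (rule sum.reindex_bij_witness[of _ uminus uminus]) auto
  moreover have "{k. 0 < c k} = {k. k < m \<and> 0 < c k} \<union> {k. m \<le> k \<and> 0 < c k}" by auto
  moreover have "finite {k. k < m \<and> 0 < c k}" "finite {k. m \<le> k \<and> 0 < c k}"
    by (rule finite_subset[OF _ fin]; auto)+
  moreover have "{k. k < m \<and> 0 < c k} \<inter> {k. m \<le> k \<and> 0 < c k} = {}" by auto
  ultimately show ?thesis
    unfolding grains_def cum_def by (simp only: sum.union_disjoint)
qed

lemma grains_mirror [simp]: "grains (mirror c) = grains c"
  unfolding grains_def by (rule sum.reindex_bij_witness[of _ uminus uminus]) auto

lemma cum_inj:
  assumes "is_config c" "is_config d" "\<And>m. cum c m = cum d m" shows "c = d"
proof
  fix i show "c i = d i" using cum_Suc[OF assms(1), of i] cum_Suc[OF assms(2), of i] assms(3) by simp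
qed

lemma cum_mono_right:
  assumes c: "is_config c" and d: "is_config d" and t: "grains c = grains d" and le: "\<And>k. k \<ge> m \<Longrightarrow> c k \<ge> d k"
  shows "cum c m \<le> cum d m"
proof -
  have "cum (mirror d) (1 - m) \<le> cum (mirror c) (1 - m)"
    by (rule cum_mono) (use c d le in auto)
  then show ?thesis using cum_mirror[OF c, of m] cum_mirror[OF d, of m] t by simp
qed

lemma config_eqI_le:
  assumes c: "is_config c" and d: "is_config d" and t: "grains c = grains d" and le: "\<And>k. c k \<le> d k"
  shows "c = d"
proof (rule cum_inj[OF c d])
  fix m show "cum c m = cum d m"
    using cum_mono[OF c d le, of m] cum_mono_right[OF d c t[symmetric] le, of m] by simp
qed

section \<open>Simultaneous firing of arbitrary sets of applicable rules\<close>

definition legal :: "config \<Rightarrow> int set \<Rightarrow> int set \<Rightarrow> bool" where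
  "legal c A B \<longleftrightarrow> A \<inter> B = {} \<and> (\<forall>i\<in>A. L_app c i) \<and> (\<forall>i\<in>B. R_app c i)"

text \<open>A firing column holds at least 2 grains and fires only once, so the truncated
  subtractions in \<open>apply_rules\<close> are exact.\<close>

lemma legal_apply:
  assumes "legal c A B"
  shows "int (apply_rules c A B i) = int (c i) - of_bool (i \<in> A) - of_bool (i \<in> B)
    + of_bool (i + 1 \<in> A) + of_bool (i - 1 \<in> B)"
proof -
  have "i \<in> A \<Longrightarrow> c i \<ge> 2" "i \<in> B \<Longrightarrow> c i \<ge> 2"
    using assms by (auto simp: legal_def L_app_def R_app_def dest!: bspec)
  moreover have "\<not> (i \<in> A \<and> i \<in> B)" using assms by (auto simp: legal_def)
  ultimately show ?thesis by (auto simp: apply_rules_def)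
qed

lemma legal_pos:
  assumes "legal c A B" shows "i \<in> A \<union> B \<Longrightarrow> 0 < c i"
  using assms by (auto simp: legal_def L_app_def R_app_def dest!: bspec)

lemma is_config_legal:
  assumes c: "is_config c" and l: "legal c A B" shows "is_config (apply_rules c A B)"
proof -
  let ?S = "{i. 0 < c i}"
  have "{i. 0 < apply_rules c A B i} \<subseteq> ?S \<union> (\<lambda>i. i - 1) ` ?S \<union> (\<lambda>i. i + 1) ` ?S"
  proof
    fix i assume "i \<in> {i. 0 < apply_rules c A B i}"
    then have "0 < int (apply_rules c A B i)" by simp
    then have "0 < c i \<or> i + 1 \<in> A \<or> i - 1 \<in> B"
      unfolding legal_apply[OF l] by (cases "i + 1 \<in> A"; cases "i - 1 \<in> B"; simp add: of_bool_def split: if_splits)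
    then show "i \<in> ?S \<union> (\<lambda>i. i - 1) ` ?S \<union> (\<lambda>i. i + 1) ` ?S"
    proof (elim disjE)
      assume "i + 1 \<in> A"
      then have "0 < c (i + 1)" using legal_pos[OF l] by blast
      then show ?thesis by (auto intro!: image_eqI[of _ _ "i + 1"])
    next
      assume "i - 1 \<in> B"
      then have "0 < c (i - 1)" using legal_pos[OF l] by blast
      then show ?thesis by (auto intro!: image_eqI[of _ _ "i - 1"])
    qed auto
  qed
  then show ?thesis using c unfolding is_config_def
    by (meson finite_Un finite_imageI finite_subset)
qed

text \<open>Only two moves carry a grain across the boundary between columns \<open>m - 1\<close>
  and \<open>m\<close>: rule L at \<open>m\<close> and rule R at \<open>m - 1\<close>.\<close>

lemma cum_legal:
  assumes c: "is_config c" and l: "legal c A B"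
  shows "cum (apply_rules c A B) m = cum c m + of_bool (m \<in> A) - of_bool (m - 1 \<in> B)"
proof -
  obtain m0 where m0: "\<And>m. m \<le> m0 \<Longrightarrow> cum c m = 0 \<and> c m = 0" using cum_low[OF c] by blast
  show ?thesis
  proof (rule cum_eqI[OF is_config_legal[OF c l], where b = m0])
    fix k
    show "cum c (k + 1) + of_bool (k + 1 \<in> A) - of_bool (k + 1 - 1 \<in> B)
        - (cum c k + of_bool (k \<in> A) - of_bool (k - 1 \<in> B)) = int (apply_rules c A B k)"
      unfolding legal_apply[OF l] cum_Suc[OF c] by simp
  next
    fix k assume k: "k \<le> m0"
    have "k \<notin> A" "k - 1 \<notin> B"
      using legal_pos[OF l, of k] legal_pos[OF l, of "k - 1"] m0[of k] m0[of "k - 1"] k by auto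
    then show "cum c k + of_bool (k \<in> A) - of_bool (k - 1 \<in> B) = 0" using m0 k by simp
  qed
qed

lemma L_app_mirror [simp]: "L_app (mirror c) i \<longleftrightarrow> R_app c (- i)"
  by (simp add: L_app_def R_app_def)

lemma R_app_mirror [simp]: "R_app (mirror c) i \<longleftrightarrow> L_app c (- i)"
  by (simp add: L_app_def R_app_def)

lemma legal_mirror: "legal c A B \<Longrightarrow> legal (mirror c) (uminus ` B) (uminus ` A)"
  by (auto simp: legal_def)

lemma apply_rules_mirror:
  assumes "legal c A B"
  shows "apply_rules (mirror c) (uminus ` B) (uminus ` A) = mirror (apply_rules c A B)"
proof
  fix i
  have "int (apply_rules (mirror c) (uminus ` B) (uminus ` A) i) = int (mirror (apply_rules c A B) i)"
    unfolding legal_apply[OF legal_mirror[OF assms]] mirror_apply legal_apply[OF assms]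
    by (simp add: uminus_mem)
  then show "apply_rules (mirror c) (uminus ` B) (uminus ` A) i = mirror (apply_rules c A B) i" by simp
qed

lemma grains_legal:
  assumes c: "is_config c" and l: "legal c A B"
  shows "grains (apply_rules c A B) = grains c"
proof -
  \<comment> \<open>The total is \<open>cum\<close> at 0 plus mirrored \<open>cum\<close> at 1; a
    grain crossing the boundary leaves one term and enters the other.\<close>
  have "cum (mirror (apply_rules c A B)) 1 = cum (mirror c) 1 + of_bool (- 1 \<in> B) - of_bool (0 \<in> A)"
    unfolding apply_rules_mirror[OF l, symmetric]
    by (subst cum_legal) (use c legal_mirror[OF l] in \<open>auto simp: uminus_mem\<close>)
  then show ?thesis
    using cum_mirror[OF c, of 0] cum_mirror[OF is_config_legal[OF c l], of 0] cum_legal[OF c l, of 0]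
    by simp
qed

section \<open>The sum of squares as a termination measure\<close>

definition energy :: "config \<Rightarrow> nat" where
  "energy c = (\<Sum>k | 0 < c k. c k * c k)"

lemma energy_eq:
  assumes "finite S" "{k. 0 < c k} \<subseteq> S" shows "energy c = (\<Sum>k\<in>S. c k * c k)"
  unfolding energy_def by (rule sum.mono_neutral_left) (use assms in auto)

lemma energy_mirror [simp]: "energy (mirror c) = energy c"
  unfolding energy_def by (rule sum.reindex_bij_witness[of _ uminus uminus]) auto

text \<open>If \<open>c i = c (i - 1) + 2 + q\<close>, the move lowers the sum of squares by
  \<open>2 * (q + 1)\<close>.\<close>

lemma energy_L:
  assumes c: "is_config c" and L: "L_app c i"
  shows "energy (apply_rules c {i} {}) < energy c"
proof -
  let ?d = "apply_rules c {i} {}"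
  let ?S = "{k. 0 < c k} \<union> {k. 0 < ?d k} \<union> {i, i - 1}"
  have l: "legal c {i} {}" using L by (simp add: legal_def)
  have fin: "finite ?S" using c is_config_legal[OF c l] by (simp add: is_config_def)
  let ?T = "?S - {i} - {i - 1}"
  have s: "(\<Sum>k\<in>?S. f k) = f i + (f (i - 1) + (\<Sum>k\<in>?T. f k))" for f :: "int \<Rightarrow> nat"
    by (subst sum.remove[of ?S i], use fin in simp, simp,
        subst sum.remove[of "?S - {i}" "i - 1"], use fin in simp, simp, simp)
  have di: "?d i = c i - 1" "?d (i - 1) = c (i - 1) + 1" by (auto simp: apply_rules_def)
  have dT: "(\<Sum>k\<in>?T. ?d k * ?d k) = (\<Sum>k\<in>?T. c k * c k)"
    by (rule sum.cong) (auto simp: apply_rules_def)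
  have e: "c (i - 1) + 2 \<le> c i" using L by (simp add: L_app_def)
  then obtain q where q: "c i = c (i - 1) + 2 + q" using le_Suc_ex by blast
  have "energy ?d = ?d i * ?d i + (?d (i - 1) * ?d (i - 1) + (\<Sum>k\<in>?T. c k * c k))"
    by (subst energy_eq[OF fin], blast, subst s, subst dT, rule refl)
  moreover have "energy c = c i * c i + (c (i - 1) * c (i - 1) + (\<Sum>k\<in>?T. c k * c k))"
    by (subst energy_eq[OF fin], blast, subst s, rule refl)
  ultimately show ?thesis using q unfolding di by (simp add: algebra_simps)
qed

lemma sspm_step_mirror:
  assumes "sspm_step c d" shows "sspm_step (mirror c) (mirror d)"
proof -
  from assms obtain i where "(L_app c i \<and> d = apply_rules c {i} {}) \<or> (R_app c i \<and> d = apply_rules c {} {i})"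
    by (auto simp: sspm_step_def)
  then show ?thesis
  proof (elim disjE conjE)
    assume a: "L_app c i" "d = apply_rules c {i} {}"
    then have "mirror d = apply_rules (mirror c) {} {- i}"
      using apply_rules_mirror[of c "{i}" "{}"] by (simp add: legal_def)
    then show ?thesis using a by (auto simp: sspm_step_def intro!: exI[of _ "- i"])
  next
    assume a: "R_app c i" "d = apply_rules c {} {i}"
    then have "mirror d = apply_rules (mirror c) {- i} {}"
      using apply_rules_mirror[of c "{}" "{i}"] by (simp add: legal_def)
    then show ?thesis using a by (auto simp: sspm_step_def intro!: exI[of _ "- i"])
  qed
qed

lemma energy_sspm_step:
  assumes c: "is_config c" and s: "sspm_step c d" shows "energy d < energy c"
proof -
  from s obtain i where "(L_app c i \<and> d = apply_rules c {i} {}) \<or> (R_app c i \<and> d = apply_rules c {} {i})"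
    by (auto simp: sspm_step_def)
  then show ?thesis
  proof (elim disjE conjE)
    assume a: "R_app c i" "d = apply_rules c {} {i}"
    then have "mirror d = apply_rules (mirror c) {- i} {}"
      using apply_rules_mirror[of c "{}" "{i}"] by (simp add: legal_def)
    with energy_L[of "mirror c" "- i"] c a show ?thesis
      by (metis L_app_mirror add.inverse_inverse energy_mirror is_config_mirror)
  qed (use energy_L c in auto)
qed

section \<open>Reachable configurations and sequential simulation\<close>

text \<open>Left of the split between columns \<open>s\<close> and \<open>s + 1\<close>, any two plateaus are separated by a cliff of
  height at least 2, and symmetrically on the right.\<close>

definition split_at :: "config \<Rightarrow> int \<Rightarrow> bool" where
  "split_at c s \<longleftrightarrow>
    (\<forall>i j. i < j \<and> j \<le> s \<and> 0 < c i \<longrightarrow> int (c i) - i - 1 \<le> int (c j) - j) \<and>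
    (\<forall>i j. s < i \<and> i < j \<and> 0 < c j \<longrightarrow> int (c j) + j - 1 \<le> int (c i) + i)"

text \<open>The invariant of all reachable configurations; the split is existential because it may
  move during the evolution.\<close>

definition pile :: "int \<Rightarrow> config \<Rightarrow> bool" where
  "pile n c \<longleftrightarrow> is_config c \<and> grains c = n \<and> (\<exists>s. split_at c s)"

lemma split_at_left: "split_at c s \<Longrightarrow> i < j \<Longrightarrow> j \<le> s \<Longrightarrow> 0 < c i \<Longrightarrow> int (c i) - i - 1 \<le> int (c j) - j"
  by (auto simp: split_at_def)

lemma split_at_right: "split_at c s \<Longrightarrow> s < i \<Longrightarrow> i < j \<Longrightarrow> 0 < c j \<Longrightarrow> int (c j) + j - 1 \<le> int (c i) + i"
  by (auto simp: split_at_def)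

lemma split_at_mirror: 
  assumes "split_at c s" shows "split_at (mirror c) (- s - 1)"
  unfolding split_at_def
proof (intro conjI allI impI; elim conjE)
  fix i j assume "i < j" "j \<le> - s - 1" "0 < mirror c i"
  then show "int (mirror c i) - i - 1 \<le> int (mirror c j) - j"
    using split_at_right[OF assms, of "- j" "- i"] by simp
next
  fix i j assume "- s - 1 < i" "i < j" "0 < mirror c j"
  then show "int (mirror c j) + j - 1 \<le> int (mirror c i) + i"
    using split_at_left[OF assms, of "- j" "- i"] by simp
qed

lemma pile_mirror [simp]: "pile n (mirror c) \<longleftrightarrow> pile n c"
  unfolding pile_def by (metis grains_mirror is_config_mirror mirror_mirror split_at_mirror)

text \<open>Right of the split heights cannot rise from one column to the next.\<close>

lemma split_L_le: "split_at c s \<Longrightarrow> c (i - 1) < c i \<Longrightarrow> i \<le> s + 1"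
  using split_at_right[of c s "i - 1" i] by force

lemma split_R_ge: "split_at c s \<Longrightarrow> c (i + 1) < c i \<Longrightarrow> s \<le> i"
  using split_at_left[of c s i "i + 1"] by force

text \<open>Only the lowered column \<open>i\<close> as right end and the raised column
  \<open>i - 1\<close> as left end of a pair can endanger the invariant; the cliff of height at
  least 2 pays for both. If \<open>i = s + 1\<close>, the split moves so that column
  \<open>i\<close> joins the left side.\<close>

lemma split_at_L:
  assumes s: "split_at c s" and L: "L_app c i"
  shows "split_at (apply_rules c {i} {}) (max s i)"
proof -
  let ?d = "apply_rules c {i} {}"
  have e: "c (i - 1) + 2 \<le> c i" using L by (simp add: L_app_def)
  have le: "i \<le> s + 1" using split_L_le[OF s] e by simp
  have d: "?d i = c i - 1" "?d (i - 1) = c (i - 1) + 1" "\<And>k. k \<noteq> i \<Longrightarrow> k \<noteq> i - 1 \<Longrightarrow> ?d k = c k"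
    by (auto simp: apply_rules_def)
  show ?thesis unfolding split_at_def
  proof (intro conjI allI impI; elim conjE)
    fix k j assume kj: "k < j" "j \<le> max s i" "0 < ?d k"
    show "int (?d k) - k - 1 \<le> int (?d j) - j"
    proof (cases "j = i")
      case True
      show ?thesis
      proof (cases "k = i - 1")
        case True then show ?thesis using \<open>j = i\<close> d e by simp
      next
        case False
        then have "k < i - 1" "0 < c k" using kj True d(3) by auto
        then have "int (c k) - k - 1 \<le> int (c (i - 1)) - (i - 1)"
          using split_at_left[OF s, of k "i - 1"] le by simp
        then show ?thesis using True False d e kj by auto
      qed
    next
      case ji: False
      then have js: "j \<le> s" using kj le by auto
      consider "k = i - 1" | "k = i" | "k \<noteq> i" "k \<noteq> i - 1" by blast
      then show ?thesis
      proof cases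
        case 1
        then have "i < j" using kj ji by auto
        then show ?thesis using 1 split_at_left[OF s, of i j] js e d by auto
      next
        case 2
        then show ?thesis using split_at_left[OF s, of i j] js e d kj by auto
      next
        case 3
        then have "int (c k) - k - 1 \<le> int (c j) - j" using split_at_left[OF s, of k j] js d kj by auto
        moreover have "c j \<le> ?d j" using ji d(2) d(3)[of j] by (cases "j = i - 1") auto
        ultimately show ?thesis using 3 d(3)[of k] by simp
      qed
    qed
  next
    fix k j assume kj: "max s i < k" "k < j" "0 < ?d j"
    then show "int (?d j) + j - 1 \<le> int (?d k) + k"
      using split_at_right[OF s, of k j] d(3)[of k] d(3)[of j] by auto
  qed
qed

lemma pile_L:
  assumes "pile n c" "L_app c i" shows "pile n (apply_rules c {i} {})"
  using assms split_at_L is_config_legal[of c "{i}" "{}"] grains_legal[of c "{i}" "{}"]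
  by (auto simp: pile_def legal_def)

lemma pile_sspm_step:
  assumes c: "pile n c" and s: "sspm_step c d" shows "pile n d"
proof -
  from s obtain i where "(L_app c i \<and> d = apply_rules c {i} {}) \<or> (R_app c i \<and> d = apply_rules c {} {i})"
    by (auto simp: sspm_step_def)
  then show ?thesis
  proof (elim disjE conjE)
    assume a: "R_app c i" "d = apply_rules c {} {i}"
    then have "mirror d = apply_rules (mirror c) {- i} {}"
      using apply_rules_mirror[of c "{}" "{i}"] by (simp add: legal_def)
    then have "pile n (mirror d)" using pile_L[of n "mirror c" "- i"] c a by simp
    then show ?thesis by simp
  qed (use pile_L c in auto)
qed

lemma pile_single: "pile (int n) (single n)"
proof -
  have "split_at (single n) 0" by (auto simp: split_at_def single_def split: if_splits)
  moreover have "{k. 0 < single n k} \<subseteq> {0}" by (auto simp: single_def split: if_splits)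
  moreover from this have "grains (single n) = (\<Sum>k\<in>{0}. int (single n k))"
    unfolding grains_def by (intro sum.mono_neutral_left) auto
  ultimately show ?thesis
    by (auto simp: pile_def is_config_def single_def intro: finite_subset)
qed

section \<open>Executing a parallel transition one grain at a time\<close>

lemma peel_L:
  assumes l: "legal c A B" and sep: "\<And>a b. a \<in> A \<Longrightarrow> b \<in> B \<Longrightarrow> a < b"
    and i: "i \<in> A" "\<And>a. a \<in> A \<Longrightarrow> i \<le> a"
  shows "sspm_step c (apply_rules c {i} {})" "legal (apply_rules c {i} {}) (A - {i}) B"
    "apply_rules (apply_rules c {i} {}) (A - {i}) B = apply_rules c A B"
proof -
  let ?d = "apply_rules c {i} {}"
  have L: "L_app c i" using l i by (auto simp: legal_def)
  then show "sspm_step c ?d" by (auto simp: sspm_step_def)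
  have li: "legal c {i} {}" using L by (simp add: legal_def)
  have d: "?d i = c i - 1" "?d (i - 1) = c (i - 1) + 1" "\<And>k. k \<noteq> i \<Longrightarrow> k \<noteq> i - 1 \<Longrightarrow> ?d k = c k"
    by (auto simp: apply_rules_def)
  \<comment> \<open>The leftmost L column goes first: lowering column \<open>i\<close> can only help
    L at \<open>i + 1\<close>, and no other firing column depends on the raised column
    \<open>i - 1\<close>.\<close>
  have "L_app ?d a" if "a \<in> A - {i}" for a
  proof -
    have "i < a" "L_app c a" using that i l by (force simp: legal_def)+
    then show ?thesis using d(1) d(3)[of a] d(3)[of "a - 1"] by (cases "a - 1 = i") (auto simp: L_app_def)
  qed
  moreover have "R_app ?d b" if "b \<in> B" for b
  proof -
    have "i < b" "R_app c b" using that sep i l by (auto simp: legal_def)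
    then show ?thesis using d(3)[of b] d(3)[of "b + 1"] by (auto simp: R_app_def)
  qed
  ultimately show ld: "legal ?d (A - {i}) B" using l by (auto simp: legal_def)
  show "apply_rules ?d (A - {i}) B = apply_rules c A B"
  proof
    fix k
    have "int (apply_rules ?d (A - {i}) B k) = int (apply_rules c A B k)"
      unfolding legal_apply[OF ld] legal_apply[OF l] legal_apply[OF li] using i(1) by auto
    then show "apply_rules ?d (A - {i}) B k = apply_rules c A B k" by simp
  qed
qed

lemma apply_rules_empty [simp]: "apply_rules c {} {} = c"
  by (simp add: apply_rules_def)

lemma sspm_steps_left:
  assumes "finite A" "legal c A B" "\<And>a b. a \<in> A \<Longrightarrow> b \<in> B \<Longrightarrow> a < b"
  shows "\<exists>d. sspm_step\<^sup>*\<^sup>* c d \<and> legal d {} B \<and> apply_rules d {} B = apply_rules c A B"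
  using assms
proof (induction "card A" arbitrary: A c)
  case 0 then show ?case by auto
next
  case (Suc m)
  then have ne: "A \<noteq> {}" by auto
  define i where "i = Min A"
  have i: "i \<in> A" "\<And>a. a \<in> A \<Longrightarrow> i \<le> a" using Suc.prems ne by (auto simp: i_def)
  note p = peel_L[OF Suc.prems(2) Suc.prems(3) i]
  have "\<exists>d. sspm_step\<^sup>*\<^sup>* (apply_rules c {i} {}) d \<and> legal d {} B
      \<and> apply_rules d {} B = apply_rules (apply_rules c {i} {}) (A - {i}) B"
    by (rule Suc.hyps(1)) (use Suc p i in auto)
  then show ?case using p by (metis converse_rtranclp_into_rtranclp)
qed

lemma sspm_steps_mirror: "sspm_step\<^sup>*\<^sup>* c d \<Longrightarrow> sspm_step\<^sup>*\<^sup>* (mirror c) (mirror d)"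
proof (induction rule: rtranclp_induct)
  case (step d e) then show ?case using sspm_step_mirror[of d e] by (meson rtranclp.rtrancl_into_rtrancl)
qed simp

lemma sspm_steps_legal:
  assumes fin: "finite A" "finite B" and l: "legal c A B" and sep: "\<And>a b. a \<in> A \<Longrightarrow> b \<in> B \<Longrightarrow> a < b"
  shows "sspm_step\<^sup>*\<^sup>* c (apply_rules c A B)"
proof -
  obtain d where d: "sspm_step\<^sup>*\<^sup>* c d" "legal d {} B" "apply_rules d {} B = apply_rules c A B"
    using sspm_steps_left[OF fin(1) l] sep by blast
  have "legal (mirror d) (uminus ` B) {}" using legal_mirror[OF d(2)] by simp
  from sspm_steps_left[OF _ this] fin(2)
  have "sspm_step\<^sup>*\<^sup>* (mirror d) (apply_rules (mirror d) (uminus ` B) {})" by fastforce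
  also have "apply_rules (mirror d) (uminus ` B) {} = mirror (apply_rules c A B)"
    using apply_rules_mirror[OF d(2)] d(3) by simp
  finally have "sspm_step\<^sup>*\<^sup>* d (apply_rules c A B)" using sspm_steps_mirror by (metis mirror_mirror)
  with d(1) show ?thesis by simp
qed

definition full_step :: "config \<Rightarrow> int set \<Rightarrow> int set \<Rightarrow> bool" where
  "full_step c A B \<longleftrightarrow> legal c A B \<and> A \<union> B = {i. L_app c i \<or> R_app c i}"

lemma pspm_step_iff:
  "pspm_step c d \<longleftrightarrow> (\<exists>A B. full_step c A B \<and> A \<union> B \<noteq> {} \<and> d = apply_rules c A B)"
  unfolding pspm_step_def full_step_def legal_def by blast

text \<open>L columns reach at most \<open>s + 1\<close> and R columns start at \<open>s\<close>;
  disjointness excludes \<open>a = b\<close>, and the cliffs exclude the crossing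
  \<open>a = s + 1\<close>, \<open>b = s\<close>.\<close>

lemma legal_sep:
  assumes "split_at c s" "legal c A B" "a \<in> A" "b \<in> B" shows "a < b"
proof -
  have ap: "c (a - 1) + 2 \<le> c a" "c (b + 1) + 2 \<le> c b" using assms by (auto simp: legal_def L_app_def R_app_def)
  then have "a \<le> s + 1" "s \<le> b" using split_L_le[OF assms(1), of a] split_R_ge[OF assms(1), of b] by auto
  moreover have "a \<noteq> b" using assms by (auto simp: legal_def)
  moreover have "\<not> (a = s + 1 \<and> b = s)" using ap by auto
  ultimately show ?thesis by linarith
qed

text \<open>The simulation passes the invariant \<open>pile\<close> and the decrease of energy from
  sequential to parallel transitions.\<close>

lemma sspm_steps_full:
  assumes c: "pile n c" and f: "full_step c A B"
  shows "sspm_step\<^sup>*\<^sup>* c (apply_rules c A B)"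
proof -
  obtain s where s: "split_at c s" using c by (auto simp: pile_def)
  have l: "legal c A B" using f by (simp add: full_step_def)
  have "A \<union> B \<subseteq> {i. 0 < c i}" using legal_pos[OF l] by auto
  moreover have "finite {i. 0 < c i}" using c by (simp add: pile_def is_config_def)
  ultimately have "finite A" "finite B" by (meson finite_Un finite_subset)+
  then show ?thesis using sspm_steps_legal[OF _ _ l] legal_sep[OF s l] by blast
qed

lemma sspm_steps_pile:
  assumes "sspm_step\<^sup>*\<^sup>* c d" "pile n c" shows "pile n d \<and> (c = d \<or> energy d < energy c)"
  using assms
proof (induction rule: rtranclp_induct)
  case (step d e)
  then show ?case using pile_sspm_step[of n d e] energy_sspm_step[of d e] by (auto simp: pile_def)
qed simp

text \<open>If no count changed, each L move at \<open>m\<close> would be matched by an R move at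
  \<open>m - 1\<close>, but two neighbouring columns cannot each exceed the other by 2. Hence a
  parallel transition lowers the energy strictly.\<close>

lemma apply_rules_neq:
  assumes c: "is_config c" and l: "legal c A B" and ne: "A \<union> B \<noteq> {}"
  shows "apply_rules c A B \<noteq> c"
proof
  assume eq: "apply_rules c A B = c"
  have *: "m \<in> A \<longleftrightarrow> m - 1 \<in> B" for m using cum_legal[OF c l, of m] unfolding eq by (auto split: if_splits)
  from ne obtain m where "m \<in> A" using *[of "_ + 1"] by fastforce
  then have "m \<in> A" "m - 1 \<in> B" using * by auto
  then show False using l by (force simp: legal_def L_app_def R_app_def)
qed

lemma pspm_step_pile:
  assumes "pile n c" "pspm_step c d" shows "pile n d" "energy d < energy c" "sspm_step\<^sup>*\<^sup>* c d"
proof -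
  obtain A B where f: "full_step c A B" "A \<union> B \<noteq> {}" "d = apply_rules c A B" using assms(2) pspm_step_iff by auto
  show s: "sspm_step\<^sup>*\<^sup>* c d" using sspm_steps_full[OF assms(1) f(1)] f(3) by simp
  moreover have "d \<noteq> c" using apply_rules_neq[of c A B] f assms(1) by (auto simp: full_step_def pile_def)
  ultimately show "pile n d" "energy d < energy c" using sspm_steps_pile[OF s assms(1)] by auto
qed

lemma pile_SSPM: "c \<in> SSPM n \<Longrightarrow> pile (int n) c"
  unfolding SSPM_def using sspm_steps_pile pile_single by blast

lemma pile_PSSPM: 
  assumes "c \<in> PSSPM n" shows "pile (int n) c"
proof -
  have "pspm_step\<^sup>*\<^sup>* (single n) c" using assms by (simp add: PSSPM_def)
  then show ?thesis by (induction rule: rtranclp_induct) (auto intro: pile_single pspm_step_pile)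
qed

section \<open>Linked pairs of configurations\<close>

text \<open>For \<open>z \<ge> 0\<close> the triangular number \<open>z * (z - 1) div 2\<close>: the
  grains of the staircase \<open>1, ..., z - 1\<close> leading up to a column of height
  \<open>z\<close>.\<close>

definition tnum :: "int \<Rightarrow> int" where
  "tnum z = \<Sum>{0..<z}"

lemma tnum_Suc: "tnum (z + 1) = tnum z + max 0 z"
proof (cases "0 \<le> z")
  case True
  then have "{0..<z + 1} = insert z {0..<z}" by auto
  then show ?thesis using True by (simp add: tnum_def)
qed (simp add: tnum_def)

lemma tnum_nonneg: "0 \<le> tnum z"
  unfolding tnum_def by (rule sum_nonneg) auto

lemma tnum_nonpos: "z \<le> 1 \<Longrightarrow> tnum z = 0"
proof -
  assume "z \<le> 1"
  then have "{0..<z} \<subseteq> {0}" by auto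
  then have "{0..<z} = {} \<or> {0..<z} = {0}" by blast
  then show ?thesis unfolding tnum_def by (elim disjE) simp_all
qed

lemma tnum_mono: "y \<le> z \<Longrightarrow> tnum y \<le> tnum z"
  unfolding tnum_def by (rule sum_mono2) auto

lemma cum_le_tnum:
  assumes "is_config c" "\<And>k. k < p \<Longrightarrow> int (c k) \<le> max 0 (h + k - p)"
  shows "cum c p \<le> tnum h"
proof -
  have "cum c p \<le> tnum (h + p - p)"
    by (rule cum_le[OF assms(1), where g = "\<lambda>k. tnum (h + k - p)"])
      (use assms(2) tnum_Suc[of "h + _ - p"] tnum_nonneg in \<open>auto simp: algebra_simps\<close>)
  then show ?thesis by simp
qed

lemma cum_ge_tnum:
  assumes "is_config c" "\<And>k. k < p \<Longrightarrow> h + k - p \<le> int (c k)"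
  shows "tnum h \<le> cum c p"
proof -
  have "tnum (h + p - p) \<le> cum c p"
    by (rule cum_ge[OF assms(1), where g = "\<lambda>k. tnum (h + k - p)" and b = "p - h"])
      (use assms(2) tnum_Suc[of "h + _ - p"] tnum_nonpos in \<open>auto simp: algebra_simps\<close>)
  then show ?thesis by simp
qed

text \<open>An ascent lies left of the split, where the earlier nonempty columns stay within the
  staircase that has height \<open>c p + 1\<close> at \<open>p\<close>.\<close>

lemma cum_ascent:
  assumes c: "pile n c" and lt: "c p < c (p + 1)" shows "cum c p \<le> tnum (int (c p) + 1)"
proof -
  obtain s where s: "split_at c s" using c by (auto simp: pile_def)
  have p: "p \<le> s" using split_L_le[OF s, of "p + 1"] lt by simp
  show ?thesis
  proof (rule cum_le_tnum)
    fix k assume "k < p"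
    then show "int (c k) \<le> max 0 (int (c p) + 1 + k - p)"
      using split_at_left[OF s, of k p] p by (cases "c k = 0") auto
  qed (use c in \<open>simp add: pile_def\<close>)
qed

text \<open>Column \<open>p - 1\<close>, of height \<open>k\<close>, is the foot of an ascent, so at
  most \<open>tnum (k + 1) + k\<close> grains precede \<open>p\<close>. This is one short of
  \<open>tnum (k + 2)\<close>, and \<open>k + 2\<close> is at most the height at
  \<open>p\<close>.\<close>

lemma cum_L_app:
  assumes c: "pile n c" and L: "L_app c p" shows "cum c p < tnum (int (c p))"
proof -
  let ?k = "int (c (p - 1))"
  have le: "c (p - 1) + 2 \<le> c p" using L by (simp add: L_app_def)
  then have "cum c (p - 1) \<le> tnum (?k + 1)" using cum_ascent[OF c, of "p - 1"] by simp
  moreover have "cum c p = cum c (p - 1) + ?k" using cum_Suc[of c "p - 1"] c by (simp add: pile_def)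
  moreover have "tnum (?k + 1 + 1) = tnum (?k + 1) + ?k + 1" using tnum_Suc[of "?k + 1"] by simp
  moreover have "tnum (?k + 1 + 1) \<le> tnum (int (c p))" by (rule tnum_mono) (use le in simp)
  ultimately show ?thesis by simp
qed

definition linked :: "config \<Rightarrow> config \<Rightarrow> bool" where
  "linked x y \<longleftrightarrow> (\<forall>m. cum y m - cum x m \<in> {0, 1})"

text \<open>The only way in which related fixed points can fail to be consecutive: the pyramid of height
  \<open>h\<close> centred at \<open>p\<close> lies between \<open>x\<close> and \<open>y\<close>. Only the counts around column \<open>p\<close> are recorded, since
  this suffices for going backwards in time.\<close>

definition skips :: "int \<Rightarrow> int \<Rightarrow> int \<Rightarrow> config \<Rightarrow> config \<Rightarrow> bool" where
  "skips n p h x y \<longleftrightarrow> n = 2 * tnum h + h \<and> cum x p = tnum h \<and> cum x (p + 1) = tnum h + h - 1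
     \<and> cum y p = tnum h + 1 \<and> cum y (p + 1) = tnum h + h"

text \<open>Had L fired at \<open>p\<close> or \<open>p + 1\<close>, the earlier configuration would
  have the required cliff there together with more grains to the left than \<open>cum_L_app\<close>
  or \<open>cum_ascent\<close> allows.\<close>

lemma no_L_into_skips:
  assumes y: "pile n y" and l: "legal y A B"
    and F: "cum (apply_rules y A B) p = tnum h + 1" "cum (apply_rules y A B) (p + 1) = tnum h + h"
  shows "p \<notin> A \<and> p + 1 \<notin> A"
proof -
  have yc: "is_config y" using y by (simp add: pile_def)
  have yp: "int (y p) = cum y (p + 1) - cum y p" using cum_Suc[OF yc] by simp
  have cp: "tnum h + 1 = cum y p + of_bool (p \<in> A) - of_bool (p - 1 \<in> B)"
    "tnum h + h = cum y (p + 1) + of_bool (p + 1 \<in> A) - of_bool (p \<in> B)"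
    using cum_legal[OF yc l, of p] cum_legal[OF yc l, of "p + 1"] F by auto
  have pA: "p \<notin> A"
  proof
    assume a: "p \<in> A"
    then have L: "L_app y p" and "p \<notin> B" using l by (auto simp: legal_def)
    then have "p - 1 \<notin> B" using l by (force simp: legal_def L_app_def R_app_def)
    then have "cum y p = tnum h" "int (y p) \<le> h" using cp a \<open>p \<notin> B\<close> yp
      by (auto simp: of_bool_def split: if_splits)
    then show False using cum_L_app[OF y L] tnum_mono[of "int (y p)" h] by simp
  qed
  moreover have "p + 1 \<notin> A"
  proof
    assume a: "p + 1 \<in> A"
    then have L: "y p + 2 \<le> y (p + 1)" using l by (auto simp: legal_def L_app_def)
    then have "p \<notin> B" using l by (auto simp: legal_def R_app_def)
    then have "tnum h + 1 \<le> cum y p" "int (y p) + 1 \<le> h" using cp a pA yp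
      by (auto simp: of_bool_def split: if_splits)
    then show False using cum_ascent[OF y, of p] L tnum_mono[of "int (y p) + 1" h] by simp
  qed
  ultimately show ?thesis by blast
qed

text \<open>Undoing the step can only raise the two counts of \<open>y\<close>, since no L move fed
  them, and by mirroring can only lower those of \<open>x\<close>. The counts already differ by 1
  and linked ones differ by at most 1, so nothing changes.\<close>

lemma skips_back:
  assumes x: "pile n x" and lx: "legal x A B" and y: "pile n y" and ly: "legal y C D"
    and li: "linked x y" and sk: "skips n p h (apply_rules x A B) (apply_rules y C D)"
  shows "skips n p h x y"
proof -
  let ?x = "apply_rules x A B" and ?y = "apply_rules y C D"
  have c: "is_config x" "is_config y" using x y by (simp_all add: pile_def)
  have Y: "p \<notin> C \<and> p + 1 \<notin> C" using no_L_into_skips[OF y ly] sk by (simp add: skips_def)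
  have gx: "grains ?x = n" using grains_legal[OF c(1) lx] x by (simp add: pile_def)
  have "- p \<notin> uminus ` B \<and> - p + 1 \<notin> uminus ` B"
  proof (rule no_L_into_skips[where y = "mirror x" and n = n])
    show "pile n (mirror x)" using x by simp
    show "legal (mirror x) (uminus ` B) (uminus ` A)" by (rule legal_mirror[OF lx])
    \<comment> \<open>The total \<open>n = 2 * tnum h + h\<close> turns the counts prescribed for
      \<open>x\<close> into those prescribed for \<open>y\<close>, with centre
      \<open>- p\<close>.\<close>
    show "cum (apply_rules (mirror x) (uminus ` B) (uminus ` A)) (- p) = tnum h + 1"
      "cum (apply_rules (mirror x) (uminus ` B) (uminus ` A)) (- p + 1) = tnum h + h"
      unfolding apply_rules_mirror[OF lx]
      using cum_mirror[OF is_config_legal[OF c(1) lx], of "p + 1"]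
        cum_mirror[OF is_config_legal[OF c(1) lx], of p] gx sk by (auto simp: skips_def)
  qed
  then have X: "p \<notin> B \<and> p - 1 \<notin> B" by (auto simp: uminus_mem)
  have D: "cum y p - cum x p \<in> {0, 1}" "cum y (p + 1) - cum x (p + 1) \<in> {0, 1}"
    using li by (auto simp: linked_def simp del: insert_iff)
  show ?thesis
    using sk X Y D unfolding skips_def cum_legal[OF c(1) lx] cum_legal[OF c(2) ly]
    by (auto simp: of_bool_def split: if_splits)
qed

text \<open>Where the counts agree, the second difference of \<open>y\<close> is at least that of
  \<open>x\<close>; where they differ by 1, it is at most that of \<open>x\<close>. So a move that
  would break the relation is available on the other side too.\<close>

lemma linked_step:
  assumes c: "is_config x" "is_config y" and li: "linked x y"
  shows "\<exists>A B C D. full_step x A B \<and> full_step y C D \<and> linked (apply_rules x A B) (apply_rules y C D)"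
proof -
  define D where "D m = cum y m - cum x m" for m
  have D01: "D m = 0 \<or> D m = 1" for m using li by (auto simp: linked_def D_def)
  have xm: "int (x m) = cum x (m + 1) - cum x m" and ym: "int (y m) = cum y (m + 1) - cum y m" for m
    using cum_Suc[OF c(1)] cum_Suc[OF c(2)] by auto
  have L0: "L_app y m" if "L_app x m" "D m = 0" for m
    using that D01[of "m - 1"] D01[of "m + 1"] xm[of m] xm[of "m - 1"] ym[of m] ym[of "m - 1"]
    by (auto simp: L_app_def D_def)
  have L1: "L_app x m" if "L_app y m" "D m = 1" for m
    using that D01[of "m - 1"] D01[of "m + 1"] xm[of m] xm[of "m - 1"] ym[of m] ym[of "m - 1"]
    by (auto simp: L_app_def D_def)
  have R0: "R_app x m" if "R_app y m" "D (m + 1) = 0" for m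
    using that D01[of m] D01[of "m + 1 + 1"] xm[of m] xm[of "m + 1"] ym[of m] ym[of "m + 1"]
    by (auto simp: R_app_def D_def)
  have R1: "R_app y m" if "R_app x m" "D (m + 1) = 1" for m
    using that D01[of m] D01[of "m + 1 + 1"] xm[of m] xm[of "m + 1"] ym[of m] ym[of "m + 1"]
    by (auto simp: R_app_def D_def)
  have nLx: "\<not> (L_app x m \<and> R_app x (m - 1))" and nLy: "\<not> (L_app y m \<and> R_app y (m - 1))" for m
    by (auto simp: L_app_def R_app_def)
  \<comment> \<open>Second differences of at least 2 and at most -2 are at least 4 apart, but the
    second difference of \<open>D\<close> lies between -2 and 2.\<close>
  have nxy: "\<not> (L_app x m \<and> R_app y (m - 1))" "\<not> (L_app y m \<and> R_app x (m - 1))" for m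
    using D01[of "m - 1"] D01[of m] D01[of "m + 1"] xm[of m] xm[of "m - 1"] ym[of m] ym[of "m - 1"]
    by (auto simp: L_app_def R_app_def D_def)
  \<comment> \<open>A column where both rules apply imitates the other configuration if that one has no choice.\<close>
  define A where "A = {i. L_app x i \<and> (R_app x i \<longrightarrow> \<not> (R_app y i \<and> \<not> L_app y i))}"
  define B where "B = {i. R_app x i \<and> (L_app x i \<longrightarrow> R_app y i \<and> \<not> L_app y i)}"
  define A' where "A' = {i. L_app y i \<and> (R_app y i \<longrightarrow> \<not> (R_app x i \<and> \<not> L_app x i))}"
  define B' where "B' = {i. R_app y i \<and> (L_app y i \<longrightarrow> R_app x i \<and> \<not> L_app x i)}"
  have fx: "full_step x A B" and fy: "full_step y A' B'"
    by (auto simp: full_step_def legal_def A_def B_def A'_def B'_def)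
  have lx: "legal x A B" and ly: "legal y A' B'" using fx fy by (auto simp: full_step_def)
  have "cum (apply_rules y A' B') m - cum (apply_rules x A B) m \<in> {0, 1}" for m
  proof -
    have a1: "m \<in> A \<Longrightarrow> D m = 0 \<Longrightarrow> m \<in> A'" and a2: "m \<in> A' \<Longrightarrow> D m = 1 \<Longrightarrow> m \<in> A"
      using L0[of m] L1[of m] by (auto simp: A_def A'_def)
    have b1: "m - 1 \<in> B' \<Longrightarrow> D m = 0 \<Longrightarrow> m - 1 \<in> B" and b2: "m - 1 \<in> B \<Longrightarrow> D m = 1 \<Longrightarrow> m - 1 \<in> B'"
      using R0[of "m - 1"] R1[of "m - 1"] by (auto simp: B_def B'_def)
    have n: "\<not> (m \<in> A \<and> m - 1 \<in> B)" "\<not> (m \<in> A' \<and> m - 1 \<in> B')" "\<not> (m \<in> A \<and> m - 1 \<in> B')" "\<not> (m \<in> A' \<and> m - 1 \<in> B)"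
      using nLx[of m] nLy[of m] nxy[of m] by (auto simp: A_def B_def A'_def B'_def)
    have "cum (apply_rules y A' B') m - cum (apply_rules x A B) m
        = D m + of_bool (m \<in> A') - of_bool (m - 1 \<in> B') - of_bool (m \<in> A) + of_bool (m - 1 \<in> B)"
      unfolding cum_legal[OF c(1) lx] cum_legal[OF c(2) ly] by (simp add: D_def)
    also have "\<dots> \<in> {0, 1}" using D01[of m] a1 a2 b1 b2 n by (auto simp: of_bool_def)
    finally show ?thesis .
  qed
  then show ?thesis using fx fy unfolding linked_def by blast
qed

section \<open>Connectedness of the parallel fixed points\<close>

text \<open>The exclusion of \<open>skips\<close> is carried along because linked fixed points alone
  may have a pyramid strictly between them.\<close>

definition adjacent :: "int \<Rightarrow> config \<Rightarrow> config \<Rightarrow> bool" where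
  "adjacent n x y \<longleftrightarrow> linked x y \<and> (\<forall>p h. \<not> skips n p h x y)"

lemma full_step_fixed: "full_step c A B \<Longrightarrow> A \<union> B = {} \<longleftrightarrow> is_fixed c"
  by (auto simp: full_step_def is_fixed_def)

lemma full_step_steps:
  assumes c: "pile n c" and f: "full_step c A B" and d: "d = apply_rules c A B"
  shows "pspm_step\<^sup>*\<^sup>* c d" "pile n d" "if is_fixed c then d = c else energy d < energy c"
proof -
  have "d = c \<and> is_fixed c \<or> pspm_step c d \<and> \<not> is_fixed c"
  proof (cases "A \<union> B = {}")
    case True
    then show ?thesis using full_step_fixed[OF f] d by auto
  next
    case False
    then show ?thesis using full_step_fixed[OF f] d f pspm_step_iff by blast
  qed
  then show "pspm_step\<^sup>*\<^sup>* c d" "pile n d" "if is_fixed c then d = c else energy d < energy c"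
    using c pspm_step_pile by auto
qed

text \<open>Both configurations run in lockstep with the choices of \<open>linked_step\<close>, a
  finished one idling; the sum of energies drops while either still moves. The contrapositive of
  \<open>skips_back\<close> preserves the exclusion.\<close>

lemma adjacent_fixed_points:
  assumes "pile n x" "pile n y" "adjacent n x y"
  shows "\<exists>f g. pspm_step\<^sup>*\<^sup>* x f \<and> is_fixed f \<and> pspm_step\<^sup>*\<^sup>* y g \<and> is_fixed g \<and> adjacent n f g"
  using assms
proof (induction "energy x + energy y" arbitrary: x y rule: less_induct)
  case less
  show ?case
  proof (cases "is_fixed x \<and> is_fixed y")
    case True
    then show ?thesis using less.prems by blast
  next
    case False
    obtain A B C D where f: "full_step x A B" "full_step y C D" and li: "linked (apply_rules x A B) (apply_rules y C D)"
      using linked_step[of x y] less.prems by (auto simp: pile_def adjacent_def)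
    note X = full_step_steps[OF less.prems(1) f(1) refl] and Y = full_step_steps[OF less.prems(2) f(2) refl]
    have adj: "adjacent n (apply_rules x A B) (apply_rules y C D)"
      using li skips_back[OF less.prems(1) _ less.prems(2)] f less.prems(3)
      by (auto simp: adjacent_def full_step_def)
    have "energy (apply_rules x A B) + energy (apply_rules y C D) < energy x + energy y"
      using X(3) Y(3) False by (auto split: if_splits)
    from less.hyps[OF this X(2) Y(2) adj] show ?thesis using X(1) Y(1) by (meson rtranclp_trans)
  qed
qed

definition joined :: "nat \<Rightarrow> config \<Rightarrow> config \<Rightarrow> bool" where
  "joined n f g \<longleftrightarrow> f \<in> PSSPM_fixed n \<and> g \<in> PSSPM_fixed n \<and> (adjacent (int n) f g \<or> adjacent (int n) g f)"

lemma joined_sym: "(joined n)\<^sup>*\<^sup>* f g \<Longrightarrow> (joined n)\<^sup>*\<^sup>* g f"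
  by (rule sympD[OF symp_rtranclp]) (auto simp: symp_def joined_def)

text \<open>At most one column admits both rules, so the two successors differ only in the choice at
  \<open>t\<close>; choosing L instead of R adds 1 to the counts at \<open>t\<close> and
  \<open>t + 1\<close>.\<close>

lemma conflict_adjacent:
  assumes d: "pile n d" and f: "full_step d A B" "full_step d C D" and t: "t \<in> A" "t \<in> D"
  shows "adjacent n (apply_rules d C D) (apply_rules d A B)"
proof -
  obtain s where s: "split_at d s" using d by (auto simp: pile_def)
  have dc: "is_config d" using d by (simp add: pile_def)
  have l: "legal d A B" "legal d C D" using f by (auto simp: full_step_def)
  have Lt: "L_app d t" and Rt: "R_app d t" using t l by (auto simp: legal_def)
  have uniq: "k = t" if "L_app d k" "R_app d k" for k
  proof -
    have *: "d (i - 1) + 2 \<le> d i \<and> d (i + 1) + 2 \<le> d i" if "i = k \<or> i = t" for i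
      using that \<open>L_app d k\<close> \<open>R_app d k\<close> Lt Rt by (auto simp: L_app_def R_app_def)
    have "i \<le> s + 1 \<and> s \<le> i" if "i = k \<or> i = t" for i
      using split_L_le[OF s, of i] split_R_ge[OF s, of i] *[OF that] by auto
    then have "k \<in> {s, s + 1}" "t \<in> {s, s + 1}" by (smt (verit) insertCI)+
    then show ?thesis using *[of k] *[of t] by auto
  qed
  have AC: "k \<in> A \<longleftrightarrow> k \<in> C" and BD: "k \<in> B \<longleftrightarrow> k \<in> D" if "k \<noteq> t" for k
    using uniq[of k] that f unfolding full_step_def legal_def by blast+
  have tn: "t \<notin> B" "t \<notin> C" using t l by (auto simp: legal_def)
  have D: "cum (apply_rules d C D) m = cum d m + of_bool (m \<in> C) - of_bool (m - 1 \<in> D)"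
    "cum (apply_rules d A B) m = cum d m + of_bool (m \<in> A) - of_bool (m - 1 \<in> B)" for m
    using cum_legal[OF dc l(2)] cum_legal[OF dc l(1)] by auto
  have diff: "cum (apply_rules d A B) m - cum (apply_rules d C D) m = of_bool (m = t) + of_bool (m = t + 1)" for m
    unfolding D using AC[of m] BD[of "m - 1"] t tn by (auto simp: of_bool_def)
  \<comment> \<open>Only \<open>p = t\<close> is possible; then column \<open>t\<close> of
    \<open>d\<close> would have height \<open>h\<close> and \<open>tnum h\<close> grains to its
    left, against \<open>cum_L_app\<close>.\<close>
  have "\<not> skips n p h (apply_rules d C D) (apply_rules d A B)" for p h
  proof
    assume sk: "skips n p h (apply_rules d C D) (apply_rules d A B)"
    then have "p = t" using diff[of p] diff[of "p + 1"] by (auto simp: skips_def of_bool_def split: if_splits)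
    have "t + 1 \<notin> A" using l Rt by (auto simp: legal_def L_app_def R_app_def)
    moreover have "t - 1 \<notin> B" using l Lt by (auto simp: legal_def L_app_def R_app_def)
    ultimately have "cum d t = tnum h" "cum d (t + 1) = tnum h + h"
      using sk t tn unfolding skips_def \<open>p = t\<close> D by (auto simp: of_bool_def split: if_splits)
    then show False using cum_L_app[OF d Lt] cum_Suc[OF dc, of t] by simp
  qed
  then show ?thesis using diff by (auto simp: adjacent_def linked_def of_bool_def)
qed

text \<open>An induction in the manner of Newman's lemma: first steps with different choices lead to
  some adjacent pair of fixed points, and the induction hypothesis at each successor connects
  \<open>f\<close> and \<open>g\<close> to that pair.\<close>

lemma PSSPM_fixed_joined:
  assumes "c \<in> PSSPM n" "pspm_step\<^sup>*\<^sup>* c f" "is_fixed f" "pspm_step\<^sup>*\<^sup>* c g" "is_fixed g"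
  shows "(joined n)\<^sup>*\<^sup>* f g"
  using assms
proof (induction "energy c" arbitrary: c f g rule: less_induct)
  case less
  note pc = pile_PSSPM[OF less.prems(1)]
  have nostep: "\<not> pspm_step e e'" if "is_fixed e" for e e'
    using that pspm_step_iff full_step_fixed by blast
  show ?case
  proof (cases "is_fixed c")
    case True
    then have "f = c" "g = c" using less.prems nostep by (metis converse_rtranclpE)+
    then show ?thesis by simp
  next
    case False
    then obtain c1 c2 where c1: "pspm_step c c1" "pspm_step\<^sup>*\<^sup>* c1 f" and c2: "pspm_step c c2" "pspm_step\<^sup>*\<^sup>* c2 g"
      using less.prems by (metis converse_rtranclpE)
    have P: "c1 \<in> PSSPM n" "c2 \<in> PSSPM n"
      using less.prems(1) c1 c2 by (auto simp: PSSPM_def)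
    have IH1: "(joined n)\<^sup>*\<^sup>* f' f" if "pspm_step\<^sup>*\<^sup>* c1 f'" "is_fixed f'" for f'
      using less.hyps[OF pspm_step_pile(2)[OF pc c1(1)] P(1) that c1(2) less.prems(3)] .
    have IH2: "(joined n)\<^sup>*\<^sup>* g' g" if "pspm_step\<^sup>*\<^sup>* c2 g'" "is_fixed g'" for g'
      using less.hyps[OF pspm_step_pile(2)[OF pc c2(1)] P(2) that c2(2) less.prems(5)] .
    have mem: "h \<in> PSSPM_fixed n" if "e \<in> PSSPM n" "pspm_step\<^sup>*\<^sup>* e h" "is_fixed h" for e h
      using that by (auto simp: PSSPM_fixed_def PSSPM_def)
    have link: ?thesis if "adjacent (int n) c1 c2 \<or> adjacent (int n) c2 c1"
    proof -
      have "\<exists>f' g'. pspm_step\<^sup>*\<^sup>* c1 f' \<and> is_fixed f' \<and> pspm_step\<^sup>*\<^sup>* c2 g' \<and> is_fixed g' \<and> joined n f' g'"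
        using that adjacent_fixed_points[OF pile_PSSPM[OF P(1)] pile_PSSPM[OF P(2)]]
          adjacent_fixed_points[OF pile_PSSPM[OF P(2)] pile_PSSPM[OF P(1)]] mem[OF P(1)] mem[OF P(2)]
        unfolding joined_def by meson
      then obtain f' g' where fg: "pspm_step\<^sup>*\<^sup>* c1 f'" "is_fixed f'" "pspm_step\<^sup>*\<^sup>* c2 g'" "is_fixed g'" "joined n f' g'"
        by blast
      have "(joined n)\<^sup>*\<^sup>* f f'" using joined_sym[OF IH1[OF fg(1,2)]] .
      also have "(joined n)\<^sup>*\<^sup>* f' g'" using fg(5) by blast
      also have "(joined n)\<^sup>*\<^sup>* g' g" using IH2[OF fg(3,4)] .
      finally show ?thesis .
    qed
    obtain A B where f1: "full_step c A B" "c1 = apply_rules c A B" using c1(1) pspm_step_iff by blast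
    obtain C D where f2: "full_step c C D" "c2 = apply_rules c C D" using c2(1) pspm_step_iff by blast
    consider "A = C" | t where "t \<in> A" "t \<notin> C" | t where "t \<in> C" "t \<notin> A" by blast
    then show ?thesis
    proof cases
      case 1
      then have "B = D" using f1(1) f2(1) unfolding full_step_def legal_def by blast
      then have "c1 = c2" using 1 f1 f2 by simp
      then show ?thesis using IH1[of g] c2(2) less.prems(5) joined_sym by blast
    next
      case 2
      then have "t \<in> D" using f1(1) f2(1) unfolding full_step_def legal_def by blast
      then show ?thesis using link conflict_adjacent[OF pc f1(1) f2(1) 2(1)] f1(2) f2(2) by blast
    next
      case 3
      then have "t \<in> B" using f1(1) f2(1) unfolding full_step_def legal_def by blast
      then show ?thesis using link conflict_adjacent[OF pc f2(1) f1(1) 3(1)] f1(2) f2(2) by blast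
    qed
  qed
qed

section \<open>Profiles of fixed points\<close>

text \<open>The difference \<open>l i - i\<close> takes at most two values, so there is at most one
  flat step. Negative heights are allowed, so that a ramp continues over all columns.\<close>

definition ramp :: "(int \<Rightarrow> int) \<Rightarrow> bool" where
  "ramp l \<longleftrightarrow> (\<forall>i j. i < j \<longrightarrow> l j - j \<le> l i - i \<and> l i - i \<le> l j - j + 1)"

definition profile :: "config \<Rightarrow> (int \<Rightarrow> int) \<Rightarrow> (int \<Rightarrow> int) \<Rightarrow> bool" where
  "profile c l r \<longleftrightarrow> ramp l \<and> ramp (\<lambda>i. r (- i)) \<and> (\<forall>i. int (c i) = max 0 (min (l i) (r i)))"

lemma rampD: "ramp l \<Longrightarrow> i < j \<Longrightarrow> l j - j \<le> l i - i \<and> l i - i \<le> l j - j + 1"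
  by (simp add: ramp_def)

lemma ramp_mono: "ramp l \<Longrightarrow> i \<le> j \<Longrightarrow> l i \<le> l j"
  using rampD[of l i j] by (cases "i = j") auto

text \<open>If two ramps crossed, the difference \<open>l i - i\<close> of one of them would drop by
  at least 2.\<close>

lemma ramp_total:
  assumes "ramp l" "ramp l'" shows "(\<forall>i. l i \<le> l' i) \<or> (\<forall>i. l' i \<le> l i)"
proof (rule ccontr)
  assume "\<not> ?thesis"
  then obtain i j where ij: "l' i < l i" "l j < l' j" by (auto simp: not_le)
  then consider "i < j" | "j < i" by (metis less_asym neqE)
  then show False using rampD[OF assms(1), of i j] rampD[OF assms(2), of i j]
      rampD[OF assms(1), of j i] rampD[OF assms(2), of j i] ij by cases auto
qed

lemma profile_mirror: "profile c l r \<Longrightarrow> profile (mirror c) (\<lambda>i. r (- i)) (\<lambda>i. l (- i))"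
  by (auto simp: profile_def min.commute)

lemma fixed_le:
  assumes "is_fixed c" "i \<le> j" shows "int (c j) - j \<le> int (c i) - i"
  using assms(2)
proof (induction j rule: int_ge_induct)
  case (step j)
  have "\<not> L_app c (j + 1)" using assms(1) by (simp add: is_fixed_def)
  then show ?case using step by (simp add: L_app_def)
qed simp

text \<open>The bound beyond \<open>s\<close> is what later allows a left and a right ramp to be
  combined by \<open>min\<close>.\<close>

lemma left_profile:
  assumes c: "is_config c" and s: "split_at c s" and f: "is_fixed c"
  shows "\<exists>l. ramp l \<and> (\<forall>i\<le>s. int (c i) = max 0 (l i)) \<and> (\<forall>i. int (c i) \<le> max 0 (l i))"
proof (cases "\<exists>i\<le>s. 0 < c i")
  case False
  then have z: "c i = 0" if "i \<le> s" for i using that by auto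
  have "int (c i) \<le> max 0 (i - s)" for i
    using fixed_le[OF f, of s i] z[of i] z[of s] by (cases "i \<le> s") auto
  then show ?thesis using z by (intro exI[of _ "\<lambda>i. i - s"]) (auto simp: ramp_def)
next
  case True
  define a where "a = Min {i. 0 < c i \<and> i \<le> s}"
  have fin: "finite {i. 0 < c i \<and> i \<le> s}"
    using c unfolding is_config_def by (rule rev_finite_subset) auto
  have a: "0 < c a" "a \<le> s" using Min_in[OF fin] True by (auto simp: a_def)
  have low: "c i = 0" if "i < a" for i
    using Min_le[OF fin, of i] that a by (fastforce simp: a_def)
  have ca: "c a = 1" using fixed_le[OF f, of "a - 1" a] low[of "a - 1"] a by simp
  have pos: "0 < c k" if "a \<le> k" "k \<le> s" for k
    using split_at_left[OF s, of a k] that a ca by (cases "k = a") auto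
  \<comment> \<open>Clamping the index to \<open>[a, s]\<close> continues the heights with slope 1
    on both sides; as column \<open>a\<close> has height 1, the ramp is at most 0 left of
    it.\<close>
  define cl where "cl i = max a (min i s)" for i
  define l where "l i = i + (int (c (cl i)) - cl i)" for i
  have cl: "a \<le> cl i" "cl i \<le> s" for i using a by (auto simp: cl_def)
  have "ramp l" unfolding ramp_def
  proof (intro allI impI)
    fix i j :: int assume "i < j"
    then have le: "cl i \<le> cl j" by (auto simp: cl_def)
    then have "int (c (cl i)) - cl i - 1 \<le> int (c (cl j)) - cl j"
      using split_at_left[OF s, of "cl i" "cl j"] cl pos by (cases "cl i = cl j") auto
    then show "l j - j \<le> l i - i \<and> l i - i \<le> l j - j + 1"
      using fixed_le[OF f le] by (simp add: l_def)
  qed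
  moreover have ls: "int (c i) = max 0 (l i)" if "i \<le> s" for i
    using that low[of i] ca a by (cases "a \<le> i") (auto simp: l_def cl_def)
  moreover have "int (c i) \<le> max 0 (l i)" for i
  proof (cases "i \<le> s")
    case False
    then have "l i = i + (int (c s) - s)" using a by (simp add: l_def cl_def)
    then show ?thesis using fixed_le[OF f, of s i] False by linarith
  qed (use ls in simp)
  ultimately show ?thesis by blast
qed

lemma is_fixed_mirror: "is_fixed c \<Longrightarrow> is_fixed (mirror c)"
  by (auto simp: is_fixed_def)

lemma profile_exists:
  assumes c: "pile n c" and f: "is_fixed c" shows "\<exists>l r. profile c l r"
proof -
  obtain s where s: "split_at c s" and cc: "is_config c" using c by (auto simp: pile_def)
  obtain l where l: "ramp l" "\<And>i. i \<le> s \<Longrightarrow> int (c i) = max 0 (l i)" "\<And>i. int (c i) \<le> max 0 (l i)"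
    using left_profile[OF cc s f] by blast
  obtain l' where l': "ramp l'" "\<And>i. i \<le> - s - 1 \<Longrightarrow> int (mirror c i) = max 0 (l' i)"
      "\<And>i. int (mirror c i) \<le> max 0 (l' i)"
    using left_profile[OF _ split_at_mirror[OF s] is_fixed_mirror[OF f]] cc by auto
  have "int (c i) = max 0 (min (l i) (l' (- i)))" for i
    using l(2)[of i] l(3)[of i] l'(2)[of "- i"] l'(3)[of "- i"] by (cases "i \<le> s") auto
  then show ?thesis using l(1) l'(1) unfolding profile_def
    by (intro exI[of _ l] exI[of _ "\<lambda>i. l' (- i)"]) simp
qed

section \<open>Comparing two fixed points with equally many grains\<close>

definition shifts :: "(int \<Rightarrow> int) \<Rightarrow> (int \<Rightarrow> int) \<Rightarrow> (int \<Rightarrow> int) \<Rightarrow> (int \<Rightarrow> int) \<Rightarrow> bool" where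
  "shifts l r l' r' \<longleftrightarrow> (\<forall>i. l i \<le> l' i) \<and> (\<forall>i. r' i \<le> r i)"

lemma shifts_up:
  assumes "profile c l r" "profile c' l' r'" "shifts l r l' r'" "c i < c' i"
  shows "l i < l' i" "l i < r' i"
proof -
  have "int (c i) = max 0 (min (l i) (r i))" "int (c' i) = max 0 (min (l' i) (r' i))" "l i \<le> l' i" "r' i \<le> r i"
    using assms by (auto simp: profile_def shifts_def)
  then show "l i < l' i" "l i < r' i" using assms(4) by linarith+
qed

lemma shifts_down:
  assumes "profile c l r" "profile c' l' r'" "shifts l r l' r'" "c' i < c i"
  shows "r' i < r i" "r' i < l i"
proof -
  have "int (c i) = max 0 (min (l i) (r i))" "int (c' i) = max 0 (min (l' i) (r' i))" "l i \<le> l' i" "r' i \<le> r i"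
    using assms by (auto simp: profile_def shifts_def)
  then show "r' i < r i" "r' i < l i" using assms(4) by linarith+
qed

text \<open>A gain forces \<open>l i < r' i\<close> and a loss forces \<open>r' k < l k\<close>,
  while \<open>l\<close> never falls and \<open>r'\<close> never rises to the right.\<close>

lemma shifts_up_before_down:
  assumes p: "profile c l r" "profile c' l' r'" "shifts l r l' r'" and i: "c i < c' i" and k: "c' k < c k"
  shows "i < k"
proof (rule ccontr)
  assume "\<not> i < k"
  then have ki: "k \<le> i" by simp
  have "l k \<le> l i" using p(1) ki ramp_mono[of l k i] by (auto simp: profile_def)
  moreover have "r' i \<le> r' k" using p(2) ki ramp_mono[of "\<lambda>i. r' (- i)" "- i" "- k"] by (auto simp: profile_def)
  ultimately show False using shifts_up[OF p i] shifts_down[OF p k] by simp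
qed

text \<open>A larger count of \<open>c\<close> at \<open>m\<close> needs a loss before
  \<open>m\<close> and, the totals being equal, a gain from \<open>m\<close> on: the wrong
  order.\<close>

lemma shifts_cum_le:
  assumes c: "pile n c" "pile n c'" and p: "profile c l r" "profile c' l' r'" "shifts l r l' r'"
  shows "cum c m \<le> cum c' m"
proof (rule ccontr)
  assume n: "\<not> ?thesis"
  have cc: "is_config c" "is_config c'" "grains c = grains c'" using c by (auto simp: pile_def)
  obtain k where k: "k < m" "c' k < c k" using cum_mono[OF cc(1,2), of m] n by (meson not_le)
  obtain i where i: "i \<ge> m" "c i < c' i" using cum_mono_right[OF cc, of m] n by (meson not_le)
  show False using shifts_up_before_down[OF p i(2) k(2)] i k by simp
qed

text \<open>Ramps are totally ordered, and if both sides moved in the same direction, one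
  configuration would dominate the other with the same total.\<close>

lemma shifts_cases:
  assumes c: "pile n c" "pile n c'" and p: "profile c l r" "profile c' l' r'" and ne: "c \<noteq> c'"
  shows "shifts l r l' r' \<or> shifts l' r' l r"
proof -
  have cc: "is_config c" "is_config c'" "grains c = grains c'" using c by (auto simp: pile_def)
  have e: "int (c i) = max 0 (min (l i) (r i))" "int (c' i) = max 0 (min (l' i) (r' i))" for i
    using p by (auto simp: profile_def)
  have le: "c i \<le> c' i" if "l i \<le> l' i" "r i \<le> r' i" for i using e[of i] that by linarith
  have ge: "c' i \<le> c i" if "l' i \<le> l i" "r' i \<le> r i" for i using e[of i] that by linarith
  have "(\<forall>i. l i \<le> l' i) \<or> (\<forall>i. l' i \<le> l i)" using p ramp_total by (auto simp: profile_def)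
  moreover have "(\<forall>i. r (- i) \<le> r' (- i)) \<or> (\<forall>i. r' (- i) \<le> r (- i))"
    using p ramp_total[of "\<lambda>i. r (- i)" "\<lambda>i. r' (- i)"] by (auto simp: profile_def)
  then have "(\<forall>i. r i \<le> r' i) \<or> (\<forall>i. r' i \<le> r i)" by (metis minus_minus)
  moreover have "\<not> ((\<forall>i. l i \<le> l' i) \<and> (\<forall>i. r i \<le> r' i))"
    using config_eqI_le[OF cc le] ne by blast
  moreover have "\<not> ((\<forall>i. l' i \<le> l i) \<and> (\<forall>i. r' i \<le> r i))"
    using config_eqI_le[OF cc(2,1) cc(3)[symmetric] ge] ne by blast
  ultimately show ?thesis unfolding shifts_def by blast
qed

section \<open>Lexicographic neighbours\<close>

lemma first_difference:
  assumes "is_config c" "is_config d" "c \<noteq> d" shows "\<exists>i. c i \<noteq> d i \<and> (\<forall>m<i. c m = d m)"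
proof -
  let ?S = "{i. c i \<noteq> d i}"
  have "?S \<subseteq> {i. 0 < c i} \<union> {i. 0 < d i}" by auto
  then have fin: "finite ?S" using assms by (auto simp: is_config_def intro: finite_subset)
  have "?S \<noteq> {}" using assms(3) by auto
  from Min_in[OF fin this] Min_le[OF fin] show ?thesis by (intro exI[of _ "Min ?S"]) fastforce
qed

lemma lex_less_total: "is_config c \<Longrightarrow> is_config d \<Longrightarrow> c \<noteq> d \<Longrightarrow> lex_less c d \<or> lex_less d c"
  using first_difference[of c d] unfolding lex_less_def by (metis linorder_neqE_nat)

lemma lex_less_asym: "lex_less c d \<Longrightarrow> \<not> lex_less d c"
  unfolding lex_less_def by (metis less_asym' linorder_neqE less_irrefl_nat)

lemma lex_less_trans: 
  assumes "lex_less c d" "lex_less d e" shows "lex_less c e"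
proof -
  obtain i j where ij: "c i < d i" "\<forall>m<i. c m = d m" "d j < e j" "\<forall>m<j. d m = e m"
    using assms by (auto simp: lex_less_def)
  have "c (min i j) < e (min i j)" using ij by (cases i j rule: linorder_cases) (auto simp: min_def)
  moreover have "\<forall>m<min i j. c m = e m" using ij by auto
  ultimately show ?thesis unfolding lex_less_def by (metis less_irrefl)
qed

lemma lex_less_of_cum:
  assumes c: "is_config c" "is_config d" and le: "\<And>m. cum c m \<le> cum d m" and ne: "c \<noteq> d"
  shows "lex_less c d"
proof -
  obtain i where i: "c i \<noteq> d i" "\<And>m. m < i \<Longrightarrow> c m = d m" using first_difference[OF c ne] by blast
  have "cum c i = cum d i" using i(2) cum_mono[OF c, of i] cum_mono[OF c(2,1), of i] by fastforce
  then have "c i \<le> d i" using le[of "i + 1"] cum_Suc[OF c(1), of i] cum_Suc[OF c(2), of i] by simp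
  then show ?thesis using i ne unfolding lex_less_def by (metis order_le_less)
qed

text \<open>The opposite shift would give \<open>c'\<close> the smaller left counts and thus put it
  first lexicographically.\<close>

lemma lex_less_shifts:
  assumes c: "pile n c" "pile n c'" and p: "profile c l r" "profile c' l' r'" and lx: "lex_less c c'"
  shows "shifts l r l' r'"
proof -
  have ne: "c \<noteq> c'" using lx by (auto simp: lex_less_def)
  have "\<not> shifts l' r' l r"
    using lex_less_of_cum[of c' c] shifts_cum_le[OF c(2,1) p(2,1)] c ne lex_less_asym[OF lx]
    by (auto simp: pile_def)
  then show ?thesis using shifts_cases[OF c p ne] by blast
qed

text \<open>All gains precede all losses, so a second gain would lift the count difference to 2 and
  a second loss would push it to -1.\<close>

lemma linked_shifts_move:
  assumes c: "pile n c" "pile n c'" and p: "profile c l r" "profile c' l' r'" "shifts l r l' r'"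
    and ne: "c \<noteq> c'" and le: "\<And>m. cum c' m - cum c m \<le> 1"
  obtains p q where "p < q" "c p < c' p" "c' q < c q"
    "\<And>i. int (c' i) = int (c i) + of_bool (i = p) - of_bool (i = q)"
proof -
  have cc: "is_config c" "is_config c'" "grains c = grains c'" using c by (auto simp: pile_def)
  define H where "H m = cum c' m - cum c m" for m
  have H: "0 \<le> H m" "H m \<le> 1" for m using shifts_cum_le[OF c p, of m] le[of m] by (auto simp: H_def)
  have HS: "H (m + 1) = H m + int (c' m) - int (c m)" for m
    using cum_Suc[OF cc(1), of m] cum_Suc[OF cc(2), of m] by (simp add: H_def)
  note ud = shifts_up_before_down[OF p]
  obtain a where a: "c a < c' a" using config_eqI_le[OF cc(2,1) cc(3)[symmetric]] ne by (metis not_le)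
  obtain b where b: "c' b < c b" using config_eqI_le[OF cc] ne by (metis not_le)
  have ab: "a < b" using ud a b by blast
  have up1: "\<not> (i < j \<and> c i < c' i \<and> c j < c' j)" for i j
  proof
    assume ij: "i < j \<and> c i < c' i \<and> c j < c' j"
    have "H (i + 1) \<le> H k" if "i + 1 \<le> k" "k \<le> j" for k
      using that
    proof (induction k rule: int_ge_induct)
      case (step k) then show ?case using HS[of k] ud[of j k] ij by force
    qed simp
    from this[of j] show False using HS[of i] HS[of j] H[of i] H[of "j + 1"] ij by simp
  qed
  have down1: "\<not> (i < j \<and> c' i < c i \<and> c' j < c j)" for i j
  proof
    assume ij: "i < j \<and> c' i < c i \<and> c' j < c j"
    have "H k \<le> H (i + 1)" if "i + 1 \<le> k" "k \<le> j" for k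
      using that
    proof (induction k rule: int_ge_induct)
      case (step k) then show ?case using HS[of k] ud[of k i] ij by force
    qed simp
    from this[of j] show False using HS[of i] HS[of j] H[of i] H[of "j + 1"] ij by simp
  qed
  have "int (c' i) = int (c i) + of_bool (i = a) - of_bool (i = b)" for i
  proof -
    have "i = a" if "c i < c' i" using up1[of i a] up1[of a i] a that by (meson linorder_neqE)
    moreover have "i = b" if "c' i < c i" using down1[of i b] down1[of b i] b that by (meson linorder_neqE)
    moreover have "int (c' i) - int (c i) \<le> 1" "int (c i) - int (c' i) \<le> 1"
      using HS[of i] H[of i] H[of "i + 1"] by auto
    ultimately show ?thesis using a b ab by (cases "c i" "c' i" rule: linorder_cases) auto
  qed
  then show ?thesis using that a b ab by blast
qed

lemma cum_move:
  assumes c: "is_config c" "is_config c'" and pq: "p < q"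
    and m: "\<And>i. int (c' i) = int (c i) + of_bool (i = p) - of_bool (i = q)"
  shows "cum c' m = cum c m + of_bool (p < m \<and> m \<le> q)"
proof -
  obtain m0 where m0: "\<And>m. m \<le> m0 \<Longrightarrow> cum c m = 0" using cum_low[OF c(1)] by blast
  show ?thesis
    by (rule cum_eqI[OF c(2), where b = "min m0 p"])
      (use cum_Suc[OF c(1)] m pq m0 in \<open>auto simp: of_bool_def\<close>)
qed

lemma adjacent_tri:
  assumes c: "pile n c" "pile n c'" "is_fixed c" "is_fixed c'" and a: "adjacent n c c'" and ne: "c \<noteq> c'"
  shows "tri c c'"
proof -
  obtain l r l' r' where p: "profile c l r" "profile c' l' r'" using profile_exists c by meson
  have li: "cum c' m - cum c m \<in> {0, 1}" for m using a by (simp add: adjacent_def linked_def)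
  have cc: "is_config c" "is_config c'" using c by (auto simp: pile_def)
  have "\<not> shifts l' r' l r"
  proof
    assume "shifts l' r' l r"
    then have "cum c m = cum c' m" for m using shifts_cum_le[OF c(2,1) p(2,1), of m] li[of m] by auto
    then show False using cum_inj[OF cc] ne by blast
  qed
  then have sh: "shifts l r l' r'" using shifts_cases[OF c(1,2) p ne] by blast
  have "cum c' m - cum c m \<le> 1" for m using li[of m] by auto
  from linked_shifts_move[OF c(1,2) p sh ne this]
  obtain i j where ij: "i < j" and mv: "\<And>k. int (c' k) = int (c k) + of_bool (k = i) - of_bool (k = j)" by blast
  have "c k = c' k" if "k \<noteq> i" "k \<noteq> j" for k using mv[of k] that by simp
  then show ?thesis unfolding tri_def using ij mv[of i] mv[of j] by (intro exI[of _ i] exI[of _ j]) simp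
qed

lemma tri_lex_less: "tri a b \<Longrightarrow> lex_less a b"
  unfolding tri_def lex_less_def
proof (elim exE conjE)
  fix i j assume "i < j" "int (a i) - int (b i) = - 1" "\<forall>m. m \<noteq> i \<and> m \<noteq> j \<longrightarrow> a m = b m"
  then show "a \<noteq> b \<and> (\<exists>i. a i < b i \<and> (\<forall>m<i. a m = b m))"
    by (intro conjI exI[of _ i]) auto
qed

text \<open>Columns left of \<open>p\<close> stay within the staircase of height \<open>h\<close> at
  \<open>p\<close>, as \<open>l k - k\<close> exceeds \<open>l p - p\<close> by at most 1. Together
  with \<open>fixed_cum_ge\<close> this determines the counts in
  \<open>adjacent_gap\<close>.\<close>

lemma profile_cum_le:
  assumes "is_config c" "profile c l r" "l p \<le> h - 1" shows "cum c p \<le> tnum h"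
proof (rule cum_le_tnum[OF assms(1)])
  fix k assume k: "k < p"
  have "int (c k) = max 0 (min (l k) (r k))" using assms(2) by (simp add: profile_def)
  moreover have "l k - k \<le> l p - p + 1" using rampD[of l k p] k assms(2) by (simp add: profile_def)
  ultimately show "int (c k) \<le> max 0 (h + k - p)" using assms(3) by linarith
qed

lemma fixed_cum_ge:
  assumes "is_config c" "is_fixed c" shows "tnum (int (c p)) \<le> cum c p"
proof (rule cum_ge_tnum[OF assms(1)])
  fix k assume "k < p"
  then show "int (c p) + k - p \<le> int (c k)" using fixed_le[OF assms(2), of k p] by simp
qed

text \<open>From \<open>a\<close> to \<open>c\<close> one grain moves from \<open>j\<close> to
  \<open>i\<close>, and from \<open>c\<close> to \<open>b\<close> one moves from \<open>j'\<close>
  to \<open>i'\<close>. Only \<open>j' = i\<close> survives, which is the case excluded by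
  \<open>skips\<close>.\<close>

lemma adjacent_gap:
  assumes a: "pile n a" "is_fixed a" and c: "pile n c" "is_fixed c" and b: "pile n b" "is_fixed b"
    and ab: "adjacent n a b" and ac: "lex_less a c" and cb: "lex_less c b"
  shows False
proof -
  obtain l0 r0 l1 r1 l2 r2 where p: "profile a l0 r0" "profile c l1 r1" "profile b l2 r2"
    using profile_exists a b c by metis
  have cfg: "is_config a" "is_config c" "is_config b" and g: "grains c = n" "grains b = n"
    using a b c by (auto simp: pile_def)
  have s1: "shifts l0 r0 l1 r1" and s2: "shifts l1 r1 l2 r2"
    using lex_less_shifts[OF a(1) c(1) p(1,2) ac] lex_less_shifts[OF c(1) b(1) p(2,3) cb] .
  then have s3: "shifts l0 r0 l2 r2" by (auto simp: shifts_def intro: order_trans)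
  have ne: "a \<noteq> c" "c \<noteq> b" using ac cb by (auto simp: lex_less_def)
  have ba: "cum b m - cum a m \<le> 1" for m using ab by (auto simp: adjacent_def linked_def dest!: spec[of _ m])
  have "cum c m - cum a m \<le> 1" for m using ba[of m] shifts_cum_le[OF c(1) b(1) p(2,3) s2, of m] by simp
  from linked_shifts_move[OF a(1) c(1) p(1,2) s1 ne(1) this]
  obtain i j where ij: "i < j" "a i < c i" "c j < a j"
    and mc: "\<And>k. int (c k) = int (a k) + of_bool (k = i) - of_bool (k = j)" by blast
  have "cum b m - cum c m \<le> 1" for m using ba[of m] shifts_cum_le[OF a(1) c(1) p(1,2) s1, of m] by simp
  from linked_shifts_move[OF c(1) b(1) p(2,3) s2 ne(2) this]
  obtain i' j' where ij': "i' < j'" "c i' < b i'" "b j' < c j'"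
    and mb: "\<And>k. int (b k) = int (c k) + of_bool (k = i') - of_bool (k = j')" by blast
  have cc: "cum c m = cum a m + of_bool (i < m \<and> m \<le> j)" for m by (rule cum_move[OF cfg(1,2) ij(1) mc])
  have cb: "cum b m = cum c m + of_bool (i' < m \<and> m \<le> j')" for m by (rule cum_move[OF cfg(2,3) ij'(1) mb])
  \<comment> \<open>The moves raise the counts on \<open>(i, j]\<close> and \<open>(i', j']\<close>.
    If these overlapped, both would contain \<open>max i i' + 1\<close>, where \<open>b\<close>
    would exceed \<open>a\<close> by 2.\<close>
  have "j \<le> i' \<or> j' \<le> i"
    using ba[of "max i i' + 1"] cc[of "max i i' + 1"] cb[of "max i i' + 1"] ij(1) ij'(1)
    by (auto simp: max_def of_bool_def split: if_splits)
  moreover have "\<not> j < i'"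
  proof
    assume h: "j < i'"
    then have "b j < a j" "a i' < b i'" using mc[of j] mb[of j] mc[of i'] mb[of i'] ij(1) ij'(1) by auto
    then show False using shifts_up_before_down[OF p(1,3) s3] h by force
  qed
  moreover have "\<not> j' < i"
  proof
    assume h: "j' < i"
    then have "b j' < a j'" "a i < b i" using mc[of j'] mb[of j'] mc[of i] mb[of i] ij(1) ij'(1) by auto
    then show False using shifts_up_before_down[OF p(1,3) s3] h by force
  qed
  \<comment> \<open>Losing and then regaining a grain in one column gives the cycle
    \<open>r2 \<le> r1 < l0 \<le> l1 < r2\<close> there.\<close>
  moreover have "j \<noteq> i'"
  proof
    assume "j = i'"
    then have "r1 j < l0 j" "l1 j < r2 j"
      using shifts_down[OF p(1,2) s1 ij(3)] shifts_up[OF p(2,3) s2 ij'(2)] by auto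
    moreover have "r2 j \<le> r1 j" "l0 j \<le> l1 j" using s1 s2 by (auto simp: shifts_def)
    ultimately show False by simp
  qed
  ultimately have ji: "j' = i" by auto
  \<comment> \<open>Column i first gains and then loses a grain, which forces c to be a perfect pyramid.\<close>
  define h where "h = int (c i)"
  have hp: "int (a i) = h - 1" "int (b i) = h - 1"
    using mc[of i] mb[of i] ij(1) ij'(1) ji by (auto simp: h_def)
  have A: "int (a i) = max 0 (min (l0 i) (r0 i))" "int (b i) = max 0 (min (l2 i) (r2 i))"
    using p by (auto simp: profile_def)
  have "l0 i < r1 i" "r1 i \<le> r0 i" using shifts_up[OF p(1,2) s1 ij(2)] s1 by (auto simp: shifts_def)
  then have "l0 i \<le> h - 1" using A hp by linarith
  \<comment> \<open>The ramp of \<open>a\<close> bounds the count from above, the height of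
    \<open>c\<close> bounds it from below, and both have the same count at \<open>i\<close>.\<close>
  then have "cum a i \<le> tnum h" by (rule profile_cum_le[OF cfg(1) p(1)])
  moreover have ca: "cum a i = cum c i" using cc[of i] by simp
  moreover have "tnum h \<le> cum c i" unfolding h_def by (rule fixed_cum_ge[OF cfg(2) c(2)])
  ultimately have L: "cum c i = tnum h" by simp
  have "r2 i < l1 i" "l1 i \<le> l2 i" using shifts_down[OF p(2,3) s2] ij'(3) ji s2 by (auto simp: shifts_def)
  \<comment> \<open>The double negation matches the mirrored ramp of \<open>profile_mirror\<close>;
    the right half is treated by reflecting \<open>b\<close> and \<open>c\<close>.\<close>
  then have "r2 (- (- i)) \<le> h - 1" using A hp by simp
  then have "cum (mirror b) (- i) \<le> tnum h" using profile_cum_le[OF _ profile_mirror[OF p(3)], of "- i" h] cfg by simp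
  moreover have "tnum h \<le> cum (mirror c) (- i)"
    using fixed_cum_ge[OF _ is_fixed_mirror[OF c(2)], of "- i"] cfg by (simp add: h_def)
  moreover have cb1: "cum b (i + 1) = cum c (i + 1)" using cb[of "i + 1"] ji by simp
  moreover have "cum b (i + 1) + cum (mirror b) (- i) = n" "cum c (i + 1) + cum (mirror c) (- i) = n"
    using cum_mirror[OF cfg(3), of "i + 1"] cum_mirror[OF cfg(2), of "i + 1"] g by simp_all
  moreover have c1: "cum c (i + 1) = tnum h + h" using cum_Suc[OF cfg(2), of i] L by (simp add: h_def)
  ultimately have "n = 2 * tnum h + h" by simp
  moreover have "cum a (i + 1) = tnum h + h - 1" using cc[of "i + 1"] c1 ij(1) by simp
  moreover have "cum b i = tnum h + 1" using cb[of i] L ij'(1) ji by simp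
  ultimately have "skips n i h a b" using L ca cb1 c1 by (simp add: skips_def)
  then show False using ab by (auto simp: adjacent_def)
qed

lemma rtranclp_exit:
  assumes "R\<^sup>*\<^sup>* x y" "P x" "\<not> P y" shows "\<exists>u v. R u v \<and> P u \<and> \<not> P v"
  using assms by (induction rule: rtranclp_induct) blast+

text \<open>Connectedness as a cut principle, applied below to initial segments of the lexicographic
  order.\<close>

lemma PSSPM_fixed_exit:
  assumes "f \<in> PSSPM_fixed n" "g \<in> PSSPM_fixed n" "P f" "\<not> P g"
  shows "\<exists>u v. u \<in> PSSPM_fixed n \<and> v \<in> PSSPM_fixed n \<and> P u \<and> \<not> P v
    \<and> (adjacent (int n) u v \<or> adjacent (int n) v u)"
proof -
  have "(joined n)\<^sup>*\<^sup>* f g"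
    by (rule PSSPM_fixed_joined[of "single n"]) (use assms in \<open>auto simp: PSSPM_fixed_def PSSPM_def\<close>)
  from rtranclp_exit[OF this, of P] assms show ?thesis unfolding joined_def by blast
qed

text \<open>Distinct adjacent fixed points increase lexicographically by
  \<open>adjacent_tri\<close>, which rules out the reverse orientation.\<close>

lemma adjacent_lex_less:
  assumes "f \<in> PSSPM_fixed n" "g \<in> PSSPM_fixed n" "lex_less f g"
    "adjacent (int n) f g \<or> adjacent (int n) g f"
  shows "adjacent (int n) f g"
proof -
  have "f \<noteq> g" using assms by (auto simp: lex_less_def)
  then have "\<not> adjacent (int n) g f"
    using adjacent_tri[of "int n" g f] tri_lex_less lex_less_asym[OF assms(3)] assms(1,2) pile_PSSPM
    by (auto simp: PSSPM_fixed_def)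
  then show ?thesis using assms(4) by blast
qed

theorem theorem1:
  fixes n :: nat and xs :: "config list"
  assumes "sorted_wrt lex_less xs" and "set xs = PSSPM_fixed n"
  shows "(\<forall>i. Suc i < length xs \<longrightarrow> tri (xs ! i) (xs ! Suc i))
       \<and> (\<forall>\<pi> \<in> SSPM_fixed n. \<forall>i j. i < length xs \<and> j < length xs
            \<and> lex_le (xs ! i) \<pi> \<and> lex_le \<pi> (xs ! j) \<longrightarrow> (\<exists>k < length xs. xs ! k = \<pi>))"
proof (intro conjI allI impI ballI; (elim conjE)?)
  have less: "lex_less (xs ! k) (xs ! l)" if "k < l" "l < length xs" for k l
    using assms(1) that by (simp add: sorted_wrt_iff_nth_less)
  have mem: "xs ! k \<in> PSSPM_fixed n" if "k < length xs" for k using assms(2) that nth_mem by blast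
  have pf: "pile (int n) f \<and> is_fixed f" if "f \<in> PSSPM_fixed n" for f
    using that pile_PSSPM by (auto simp: PSSPM_fixed_def)
  {
    fix i assume i: "Suc i < length xs"
    \<comment> \<open>The cut is placed after \<open>xs ! i\<close>. The adjacent pair across it has
      no listed fixed point between its members, so it must be \<open>xs ! i\<close> and
      \<open>xs ! Suc i\<close>.\<close>
    let ?P = "\<lambda>f. \<exists>k\<le>i. f = xs ! k"
    have "\<not> ?P (xs ! Suc i)"
      using less[of _ "Suc i"] i by (metis le_imp_less_Suc lex_less_asym)
    with PSSPM_fixed_exit[OF mem mem, of i "Suc i" ?P] i
    obtain u v where uv: "u \<in> PSSPM_fixed n" "v \<in> PSSPM_fixed n" "?P u" "\<not> ?P v"
      "adjacent (int n) u v \<or> adjacent (int n) v u" by fastforce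
    obtain k where k: "u = xs ! k" "k \<le> i" using uv(3) by blast
    obtain l where l: "v = xs ! l" "l < length xs" using uv(2) assms(2) by (metis in_set_conv_nth)
    have il: "i < l" using l uv(4) not_le by blast
    have adj: "adjacent (int n) u v"
      by (rule adjacent_lex_less[OF uv(1,2) _ uv(5)]) (use less k l il in simp)
    have gap: "\<not> (k < m \<and> m < l)" for m
      using adjacent_gap[of "int n" u "xs ! m" v] pf uv(1,2) mem[of m] adj less[of k m] less[of m l] k l by auto
    have "k = i" "l = Suc i" using gap[of i] gap[of "Suc i"] k il by auto
    moreover have "tri u v" using adjacent_tri[OF _ _ _ _ adj] pf uv(1,2,3,4) by metis
    ultimately show "tri (xs ! i) (xs ! Suc i)" using k l by simp
  next
    fix \<pi> i j
    assume \<pi>: "\<pi> \<in> SSPM_fixed n" and ij: "i < length xs" "j < length xs"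
      and le: "lex_le (xs ! i) \<pi>" "lex_le \<pi> (xs ! j)"
    have p\<pi>: "pile (int n) \<pi>" "is_fixed \<pi>" using \<pi> pile_SSPM by (auto simp: SSPM_fixed_def)
    show "\<exists>k<length xs. xs ! k = \<pi>"
    proof (rule ccontr)
      assume "\<not> ?thesis"
      then have nin: "\<pi> \<notin> PSSPM_fixed n" using assms(2) by (metis in_set_conv_nth)
      then have "lex_less (xs ! i) \<pi>" "lex_less \<pi> (xs ! j)" using le mem ij by (auto simp: lex_le_def)
      \<comment> \<open>A missing \<open>\<pi>\<close> would separate the parallel fixed points, and
        some adjacent pair would enclose it; \<open>adjacent_gap\<close> applies because
        sequentially reachable configurations satisfy \<open>pile\<close> too.\<close>
      with PSSPM_fixed_exit[OF mem mem, of i j "\<lambda>f. lex_less f \<pi>"] ij lex_less_asym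
      obtain u v where uv: "u \<in> PSSPM_fixed n" "v \<in> PSSPM_fixed n" "lex_less u \<pi>" "\<not> lex_less v \<pi>"
        "adjacent (int n) u v \<or> adjacent (int n) v u" by blast
      have \<pi>v: "lex_less \<pi> v" using lex_less_total[of \<pi> v] uv(2,4) nin pf p\<pi> by (auto simp: pile_def)
      have "adjacent (int n) u v"
        by (rule adjacent_lex_less[OF uv(1,2) lex_less_trans[OF uv(3) \<pi>v] uv(5)])
      then show False using adjacent_gap[of "int n" u \<pi> v] pf uv(1,2,3) p\<pi> \<pi>v by blast
    qed
  }
qed

end
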